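(* Let $(G,w,u)$ be an instance of Directed Vertexnim in the misère version, where $G$ is strongly connected, with a loop on each vertex. Deciding whether $(G,w,u)$ is $\mathcal{P}$ or $\mathcal{N}$ can be done in time $O(|V(G)||E(G)|)$.
   Context: Directed Vertexnim: let $G=(V,E)$ be a strongly connected digraph, $w:V\rightarrow \mathbb{N}_{>0}$ a weight function on the vertices, and $u\in V$ the starting current vertex. Two players alternately decrease the weight of the current vertex $u$ by a positive amount and then choose an out-neighbour of $u$ as the new current vertex. When the weight of a vertex $v$ is set to $0$, $v$ is removed and every pair of arcs $(p,v),(v,s)$ (with $p,s$ not necessarily distinct) is replaced by an arc $(p,s)$. The game ends when $G$ is empty. In the misère version, the player making the last move loses. A $\mathcal{P}$ position is one from which the second player has a winning strategy, an $\mathcal{N}$ position one from which the player to move can win. *)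

theory Defs
  imports "Graph_Theory.Graph_Theory"
begin

section \<open>Directed Vertexnim\<close>

definition contract_vertex :: "'a pair_pre_digraph \<Rightarrow> 'a \<Rightarrow> 'a pair_pre_digraph" where
  "contract_vertex G v =
     \<lparr> pverts = pverts G - {v},
       parcs = {(p, s). p \<noteq> v \<and> s \<noteq> v \<and>
                  ((p, s) \<in> parcs G \<or> ((p, v) \<in> parcs G \<and> (v, s) \<in> parcs G))} \<rparr>"

text \<open>A position consists of a digraph, the weights, and the current vertex.  Once the digraph is
  empty the game is over and the third component is meaningless.\<close>

type_synonym 'a position = "'a pair_pre_digraph \<times> ('a \<Rightarrow> nat) \<times> 'a"

inductive vmove :: "'a position \<Rightarrow> 'a position \<Rightarrow> bool" where
  decrease: "\<lbrakk> u \<in> pverts G; 0 < k; k < w u; (u, v) \<in> parcs G \<rbrakk>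
     \<Longrightarrow> vmove (G, w, u) (G, w(u := k), v)"
| remove: "\<lbrakk> u \<in> pverts G; 0 < w u; (u, v) \<in> parcs G; v \<noteq> u \<rbrakk>
     \<Longrightarrow> vmove (G, w, u) (contract_vertex G u, w(u := 0), v)"
| remove_last: "\<lbrakk> pverts G = {u}; 0 < w u \<rbrakk>
     \<Longrightarrow> vmove (G, w, u) (contract_vertex G u, w(u := 0), u)"

definition game_over :: "'a position \<Rightarrow> bool" where
  "game_over p \<longleftrightarrow> pverts (fst p) = {}"

definition complete_play :: "'a position \<Rightarrow> 'a position list \<Rightarrow> bool" where
  "complete_play p ps \<longleftrightarrow>
     ps \<noteq> [] \<and> hd ps = p \<and> successively vmove ps \<and> game_over (last ps)"

text \<open>Positions never repeat, because every move lowers the weight of a vertex.  So plays are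
  finite, and memoryless strategies are no restriction.\<close>

definition legal_strategy :: "('a position \<Rightarrow> 'a position) \<Rightarrow> bool" where
  "legal_strategy \<sigma> \<longleftrightarrow> (\<forall>p q. vmove p q \<longrightarrow> vmove p (\<sigma> p))"

text \<open>The first player makes the moves with even index (\<open>r = 0\<close>), the second player
  those with odd index (\<open>r = 1\<close>).\<close>

definition follows :: "('a position \<Rightarrow> 'a position) \<Rightarrow> nat \<Rightarrow> 'a position list \<Rightarrow> bool" where
  "follows \<sigma> r ps \<longleftrightarrow> (\<forall>i. Suc i < length ps \<and> i mod 2 = r \<longrightarrow> ps ! Suc i = \<sigma> (ps ! i))"

text \<open>A play with \<open>length ps - 1\<close> moves has its last move made by the first player
  iff that number is odd; under the misere rule the first player then loses.\<close>

definition misere_won_by_second :: "'a position list \<Rightarrow> bool" where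
  "misere_won_by_second ps \<longleftrightarrow> odd (length ps - 1)"

definition misere_P :: "'a position \<Rightarrow> bool" where
  "misere_P p \<longleftrightarrow> (\<exists>\<sigma>. legal_strategy \<sigma> \<and>
     (\<forall>ps. complete_play p ps \<and> follows \<sigma> 1 ps \<longrightarrow> misere_won_by_second ps))"

definition misere_N :: "'a position \<Rightarrow> bool" where
  "misere_N p \<longleftrightarrow> (\<exists>\<sigma>. legal_strategy \<sigma> \<and>
     (\<forall>ps. complete_play p ps \<and> follows \<sigma> 0 ps \<longrightarrow> \<not> misere_won_by_second ps))"

definition vertexnim_inst :: "'a pair_pre_digraph \<Rightarrow> ('a \<Rightarrow> nat) \<Rightarrow> 'a \<Rightarrow> bool" where
  "vertexnim_inst G w u \<longleftrightarrow>
     pair_fin_digraph G \<and> strongly_connected (with_proj G) \<and>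
     (\<forall>v \<in> pverts G. 0 < w v) \<and> u \<in> pverts G"


section \<open>Model of computation\<close>

text \<open>Running times refer to a random-access machine with uniform cost measure and the usual
  instruction set of addition, truncated subtraction, indirect addressing and test for nonzero.
  Programs are structured, and memory is divided into named unbounded arrays of natural numbers;
  a fixed program uses only finitely many of them, so interleaving them in a single memory costs
  only a constant factor.  Scalar variables are the cells with index 0.  Every node of an
  expression and every command executed costs one time unit.\<close>

type_synonym memory = "string \<Rightarrow> nat \<Rightarrow> nat"

datatype expr =
    Num nat
  | Cell string expr
  | Add expr expr
  | Sub expr expr

datatype cmd =
    Skip
  | Assign string expr expr
  | Seq cmd cmd
  | IfNz expr cmd cmd
  | WhileNz expr cmd

primrec expr_val :: "expr \<Rightarrow> memory \<Rightarrow> nat" where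
  "expr_val (Num k) s = k"
| "expr_val (Cell a i) s = s a (expr_val i s)"
| "expr_val (Add e f) s = expr_val e s + expr_val f s"
| "expr_val (Sub e f) s = expr_val e s - expr_val f s"

primrec expr_time :: "expr \<Rightarrow> nat" where
  "expr_time (Num k) = 1"
| "expr_time (Cell a i) = 1 + expr_time i"
| "expr_time (Add e f) = 1 + expr_time e + expr_time f"
| "expr_time (Sub e f) = 1 + expr_time e + expr_time f"

text \<open>\<open>exec c s t s'\<close>: program \<open>c\<close>, started in memory \<open>s\<close>, halts after \<open>t\<close> time units
  in memory \<open>s'\<close>.\<close>

inductive exec :: "cmd \<Rightarrow> memory \<Rightarrow> nat \<Rightarrow> memory \<Rightarrow> bool" where
  Skip: "exec Skip s 1 s"
| Assign: "exec (Assign a i e) s (1 + expr_time i + expr_time e)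
     (s(a := (s a)(expr_val i s := expr_val e s)))"
| Seq: "\<lbrakk> exec c s t s'; exec d s' t' s'' \<rbrakk> \<Longrightarrow> exec (Seq c d) s (t + t') s''"
| IfTrue: "\<lbrakk> expr_val b s \<noteq> 0; exec c s t s' \<rbrakk>
     \<Longrightarrow> exec (IfNz b c d) s (1 + expr_time b + t) s'"
| IfFalse: "\<lbrakk> expr_val b s = 0; exec d s t s' \<rbrakk>
     \<Longrightarrow> exec (IfNz b c d) s (1 + expr_time b + t) s'"
| WhileTrue: "\<lbrakk> expr_val b s \<noteq> 0; exec c s t s'; exec (WhileNz b c) s' t' s'' \<rbrakk>
     \<Longrightarrow> exec (WhileNz b c) s (1 + expr_time b + t + t') s''"
| WhileFalse: "expr_val b s = 0 \<Longrightarrow> exec (WhileNz b c) s (1 + expr_time b) s"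

lemma exec_deterministic:
  "exec c s t s' \<Longrightarrow> exec c s t2 s2 \<Longrightarrow> t2 = t \<and> s2 = s'"
proof (induction arbitrary: t2 s2 rule: exec.induct)
  case Skip
  from Skip.prems show ?case by cases auto
next
  case Assign
  from Assign.prems show ?case by cases auto
next
  case (Seq c s t s' d t' s'')
  from Seq.prems show ?case by cases (metis Seq.IH)
next
  case IfTrue
  from IfTrue.prems show ?case by cases (use IfTrue.hyps IfTrue.IH in \<open>fastforce+\<close>)
next
  case IfFalse
  from IfFalse.prems show ?case by cases (use IfFalse.hyps IfFalse.IH in \<open>fastforce+\<close>)
next
  case WhileTrue
  from WhileTrue.prems show ?case
    by cases (metis WhileTrue.IH, use WhileTrue.hyps in simp)
next
  case WhileFalse
  from WhileFalse.prems show ?case by cases (use WhileFalse.hyps in simp_all)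
qed

text \<open>An instance on the vertices \<open>0, \<dots>, n - 1\<close> is presented by the numbers of vertices and
  arcs, the current vertex, the weights, and the list \<open>es\<close> of arcs.  All other memory is 0.\<close>

definition input_memory ::
  "nat pair_pre_digraph \<Rightarrow> (nat \<Rightarrow> nat) \<Rightarrow> nat \<Rightarrow> (nat \<times> nat) list \<Rightarrow> memory" where
  "input_memory G w u es = (\<lambda>_ _. 0)
     (''n'' := (\<lambda>_. 0)(0 := card (pverts G)),
      ''m'' := (\<lambda>_. 0)(0 := length es),
      ''u'' := (\<lambda>_. 0)(0 := u),
      ''w'' := (\<lambda>i. if i < card (pverts G) then w i else 0),
      ''src'' := (\<lambda>j. if j < length es then fst (es ! j) else 0),
      ''dst'' := (\<lambda>j. if j < length es then snd (es ! j) else 0))"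

definition answer :: "memory \<Rightarrow> nat" where
  "answer s = s ''answer'' 0"

end

theory Submission
  imports Defs
begin

text \<open>A vertex of weight at least 2 is winning: its owner may either remove it or, using the loop, pass
  the choice among the removing moves to the opponent.  So only walks through vertices of weight 1
  matter.  Consider a sink component \<open>C\<close> of the graph induced by the vertices whose outcome is still
  open, all arcs leaving \<open>C\<close> going to winning vertices.  Leaving \<open>C\<close> loses, removing a vertex keeps the
  rest of \<open>C\<close> strongly connected, and whoever removes the last vertex of \<open>C\<close> loses, either by moving to
  a winning vertex or, under the misere rule, because the graph is empty.  Hence \<open>C\<close> consists of
  losing vertices if \<open>|C|\<close> is odd, which makes their predecessors winning, and of winning vertices if
  \<open>|C|\<close> is even.  This labels at least one vertex, so there are at most \<open>|V|\<close> rounds.  In each round, one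
  finds a vertex of a sink component in time \<open>O(|E|)\<close> as the last root of a sweep of backward searches
  over all open vertices, and its component by a forward search.\<close>

subsection \<open>Winning and losing positions\<close>

text \<open>The overview reasons in one fixed graph, but every removal contracts it, so labels
  computed once must keep their meaning along a play. The way out: a component already peeled off
  has no arc to an unlabelled vertex, so contracting such a vertex changes no arc out of that
  component. The part of a labelling built before the current vertex's own component thus carries
  over, and that component without the vertex is a sink component of the other parity. Hence
  soundness is proved by induction on the total weight for all derivable labellings at once, not
  just for the one the program computes. Since outcomes are defined by strategies and plays, the
  equivalences with \<open>misere_P\<close> and \<open>misere_N\<close> also need that no position
  is both; this rests on two legal strategies always producing a complete play. For the time bound,
  all searches of a sweep draw on one common potential, which makes a round linear in |V| + |E|; the
  loops give |V| \<le> |E|.\<close>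

inductive wins :: "'a position \<Rightarrow> bool" and loses :: "'a position \<Rightarrow> bool" where
  wins_over: "game_over p \<Longrightarrow> wins p"
| wins_move: "vmove p q \<Longrightarrow> loses q \<Longrightarrow> wins p"
| losesI: "\<not> game_over p \<Longrightarrow> (\<And>q. vmove p q \<Longrightarrow> wins q) \<Longrightarrow> loses p"

lemma not_vmove_game_over: "game_over p \<Longrightarrow> \<not> vmove p q"
  by (auto simp: game_over_def elim: vmove.cases)

lemma losesD:
  assumes "loses p"
  shows "\<not> game_over p" and "vmove p q \<Longrightarrow> wins q"
  using assms by (cases, simp)+

lemma all_nat_split: "(\<forall>i. P i) \<longleftrightarrow> P 0 \<and> (\<forall>i. P (Suc i))" for P :: "nat \<Rightarrow> bool"
  by (metis not0_implies_Suc)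

text \<open>Dropping the first position shifts every index by one, so the two players exchange
  parities.\<close>

lemma follows_0_Cons:
  "follows \<sigma> 0 (p # q # ps) \<longleftrightarrow> q = \<sigma> p \<and> follows \<sigma> 1 (q # ps)"
proof -
  have "(Suc i mod 2 = 0) = (i mod 2 = 1)" for i :: nat
    by presburger
  then show ?thesis
    unfolding follows_def by (subst all_nat_split) (simp del: One_nat_def)
qed

lemma follows_1_Cons: "follows \<sigma> 1 (p # ps) \<longleftrightarrow> follows \<sigma> 0 ps"
proof -
  have "(Suc i mod 2 = 1) = (i mod 2 = 0)" for i :: nat
    by presburger
  then show ?thesis
    unfolding follows_def by (subst all_nat_split) (simp del: One_nat_def)
qed

lemma complete_play_Cons:
  "complete_play p (q # r # ps) \<longleftrightarrow> q = p \<and> vmove p r \<and> complete_play r (r # ps)"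
  by (auto simp: complete_play_def)

lemma complete_play_singleton: "complete_play p [q] \<longleftrightarrow> q = p \<and> game_over p"
  by (auto simp: complete_play_def)

text \<open>A single strategy that is optimal for either player. The second branch only makes it
  legal in positions from which nothing can be gained.\<close>

definition best_reply :: "'a position \<Rightarrow> 'a position" where
  "best_reply p =
     (if \<exists>q. vmove p q \<and> loses q then SOME q. vmove p q \<and> loses q else SOME q. vmove p q)"

lemma legal_best_reply: "legal_strategy best_reply"
proof -
  have "vmove p (best_reply p)" if "vmove p q" for p q :: "'a position"
  proof (cases "\<exists>q. vmove p q \<and> loses q")
    case True
    from someI_ex[OF this] show ?thesis
      by (simp only: best_reply_def if_P[OF True])
  next
    case False
    have "\<exists>q. vmove p q" using that by blast
    then have "vmove p (SOME q. vmove p q)" by (rule someI_ex)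
    then show ?thesis
      by (simp only: best_reply_def if_not_P[OF False])
  qed
  then show ?thesis
    by (auto simp: legal_strategy_def)
qed

lemma loses_best_reply: "wins p \<Longrightarrow> \<not> game_over p \<Longrightarrow> loses (best_reply p)"
proof (erule wins.cases)
  fix p' q assume "p = p'" "vmove p' q" "loses q"
  then have "\<exists>q. vmove p q \<and> loses q" by blast
  from someI_ex[OF this] this show "loses (best_reply p)"
    by (simp add: best_reply_def)
qed simp

text \<open>Each move hands over the turn, so both claims must be proved together. The play without
  moves carries the misere convention: at an empty graph the player to move \<open>wins\<close>, and
  zero is even.\<close>

lemma best_reply_play:
  "complete_play p ps \<Longrightarrow>
     (loses p \<and> follows best_reply 1 ps \<longrightarrow> odd (length ps - 1)) \<and>
     (wins p \<and> follows best_reply 0 ps \<longrightarrow> even (length ps - 1))"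
proof (induction ps arbitrary: p)
  case Nil
  then show ?case by (simp add: complete_play_def)
next
  case (Cons p' ps)
  show ?case
  proof (cases ps)
    case Nil
    then have "game_over p"
      using Cons.prems by (simp add: complete_play_singleton)
    then have "\<not> loses p"
      using losesD by blast
    with Nil show ?thesis by simp
  next
    case (Cons q qs)
    then have m: "p' = p" "vmove p q" "complete_play q ps"
      using Cons.prems by (auto simp: complete_play_Cons)
    have "wins q" if "loses p"
      using that m(2) by (rule losesD)
    moreover have "loses (best_reply p)" if "wins p"
      using that m(2) loses_best_reply not_vmove_game_over by blast
    moreover have "follows best_reply 1 (p' # ps) \<longleftrightarrow> follows best_reply 0 ps"
      by (rule follows_1_Cons)
    moreover have "follows best_reply 0 (p' # ps) \<longleftrightarrow> q = best_reply p \<and> follows best_reply 1 ps"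
      by (simp only: Cons m follows_0_Cons)
    moreover have "length (p' # ps) - 1 = Suc (length ps - 1)"
      by (simp add: Cons)
    ultimately show ?thesis
      using Cons.IH[OF m(3)] by (metis even_Suc)
  qed
qed

lemma loses_imp_misere_P: "loses p \<Longrightarrow> misere_P p"
  unfolding misere_P_def misere_won_by_second_def
  by (intro exI[of _ best_reply] conjI legal_best_reply allI impI) (meson best_reply_play)

lemma wins_imp_misere_N: "wins p \<Longrightarrow> misere_N p"
  unfolding misere_N_def misere_won_by_second_def
  by (intro exI[of _ best_reply] conjI legal_best_reply allI impI) (meson best_reply_play)

section \<open>Termination and determinacy of the game\<close>

fun total_weight :: "'a position \<Rightarrow> nat" where
  "total_weight (G, w, u) = sum w (pverts G)"

lemma total_weight_vmove:
  assumes "vmove p q" and "finite (pverts (fst p))"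
  shows "total_weight q < total_weight p"
  using assms
proof cases
  case (decrease u G k w v)
  then show ?thesis
    using assms(2) sum.remove[of "pverts G" u w] sum.remove[of "pverts G" u "w(u := k)"] by simp
next
  case (remove u G w v)
  then show ?thesis
    using assms(2) sum.remove[of "pverts G" u w] by (simp add: contract_vertex_def)
next
  case (remove_last G u w)
  then show ?thesis
    by (simp add: contract_vertex_def)
qed

lemma finite_vmove:
  "vmove p q \<Longrightarrow> finite (pverts (fst p)) \<Longrightarrow> finite (pverts (fst q))"
  by (erule vmove.cases) (auto simp: contract_vertex_def)

text \<open>Determinacy, by induction on the total weight. A nonempty position without moves counts
  vacuously as \<open>loses\<close>; regularity excludes such positions below.\<close>

lemma wins_or_loses: "finite (pverts (fst p)) \<Longrightarrow> wins p \<or> loses p"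
proof (induction p rule: measure_induct_rule[of total_weight])
  case (less p)
  then have "wins q \<or> loses q" if "vmove p q" for q
    using that finite_vmove total_weight_vmove by blast
  then show ?case
    using losesI[of p] wins_move[of p] wins_over[of p] by blast
qed

subsection \<open>Regular positions\<close>

text \<open>Paths are confined to \<open>C\<close>. The empty set and all singletons qualify, by
  reflexivity of the closure.\<close>

definition strong_on :: "('a \<times> 'a) set \<Rightarrow> 'a set \<Rightarrow> bool" where
  "strong_on A C \<longleftrightarrow> (\<forall>x\<in>C. \<forall>y\<in>C. (x, y) \<in> (A \<inter> C \<times> C)\<^sup>*)"

lemma parcs_contract_vertex:
  "parcs (contract_vertex G u) = {(p, s). p \<noteq> u \<and> s \<noteq> u \<and>
     ((p, s) \<in> parcs G \<or> ((p, u) \<in> parcs G \<and> (u, s) \<in> parcs G))}"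
  by (simp add: contract_vertex_def)

text \<open>A path that visits \<open>u\<close> is rerouted: the vertex before \<open>u\<close> gets
  a direct arc to the vertex after it.\<close>

lemma strong_on_contract_vertex:
  assumes "strong_on (parcs G) C"
  shows "strong_on (parcs (contract_vertex G u)) (C - {u})"
proof -
  let ?B = "parcs G \<inter> C \<times> C"
  let ?B' = "parcs (contract_vertex G u) \<inter> (C - {u}) \<times> (C - {u})"
  \<comment> \<open>The second conjunct describes a path currently at \<open>u\<close>:
    \<open>p\<close> is the last vertex before \<open>u\<close>, from which the contracted graph
    continues directly to whatever follows.\<close>
  have "(y \<noteq> u \<longrightarrow> (x, y) \<in> ?B'\<^sup>*) \<and> (y = u \<longrightarrow> (\<exists>p. p \<noteq> u \<and> (x, p) \<in> ?B'\<^sup>* \<and> (p, u) \<in> ?B))"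
    if "(x, y) \<in> ?B\<^sup>*" "x \<noteq> u" for x y
    using that
  proof (induction rule: rtrancl_induct)
    case base
    then show ?case by simp
  next
    case (step y z)
    show ?case
    proof (cases "z = u")
      case True
      then show ?thesis using step by auto
    next
      case False
      then obtain p where p: "(x, p) \<in> ?B'\<^sup>*" "(p, z) \<in> ?B'"
        using step by (cases "y = u") (auto simp: parcs_contract_vertex)
      then have "(x, z) \<in> ?B'\<^sup>*"
        by (rule rtrancl.rtrancl_into_rtrancl)
      with False show ?thesis by simp
    qed
  qed
  then show ?thesis
    using assms unfolding strong_on_def by blast
qed

lemma strong_on_successor:
  assumes "strong_on A C" "x \<in> C" "y \<in> C" "x \<noteq> y"
  obtains z where "(x, z) \<in> A" "z \<in> C" "z \<noteq> x"
proof -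
  have "(x, y) \<in> (A \<inter> C \<times> C)\<^sup>*"
    using assms by (auto simp: strong_on_def)
  then have "\<exists>z. (x, z) \<in> A \<and> z \<in> C \<and> z \<noteq> x"
    using \<open>x \<noteq> y\<close> by (induction rule: converse_rtrancl_induct) auto
  then show thesis
    using that by blast
qed

text \<open>The invariant of play. It covers the empty digraph at the end, where the current vertex
  is meaningless.\<close>

fun regular :: "'a position \<Rightarrow> bool" where
  "regular (G, w, u) \<longleftrightarrow>
     finite (pverts G) \<and> parcs G \<subseteq> pverts G \<times> pverts G \<and> strong_on (parcs G) (pverts G) \<and>
     (\<forall>v \<in> pverts G. 0 < w v \<and> (v, v) \<in> parcs G) \<and> (pverts G \<noteq> {} \<longrightarrow> u \<in> pverts G)"

lemma regular_vmove: "vmove p q \<Longrightarrow> regular p \<Longrightarrow> regular q"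
proof (induction rule: vmove.induct)
  case (decrease u G k w v)
  then show ?case by auto
next
  case (remove u G w v)
  then show ?case
    using strong_on_contract_vertex[of G "pverts G" u] by (auto simp: contract_vertex_def)
next
  case (remove_last G u w)
  then show ?case
    by (auto simp: contract_vertex_def strong_on_def)
qed

lemma regular_vmove_exists:
  assumes "regular p" "\<not> game_over p"
  shows "\<exists>q. vmove p q"
proof -
  obtain G w u where p: "p = (G, w, u)"
    by (cases p) auto
  have u: "u \<in> pverts G" "0 < w u"
    using assms by (auto simp: p game_over_def)
  show ?thesis
  proof (cases "pverts G = {u}")
    case True
    then show ?thesis using u vmove.remove_last[of G u w] unfolding p by blast
  next
    case False
    then obtain x where "x \<in> pverts G" "u \<noteq> x" using u by blast
    moreover have "strong_on (parcs G) (pverts G)" using assms by (simp add: p)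
    ultimately obtain v where "(u, v) \<in> parcs G" "v \<noteq> u"
      using u(1) strong_on_successor[of "parcs G" "pverts G" u x] by blast
    then show ?thesis using u vmove.remove[of u G w v] unfolding p by blast
  qed
qed

text \<open>After the first move the players swap roles, so the induction hypothesis is applied with
  \<open>\<tau>\<close> and \<open>\<sigma>\<close> exchanged.\<close>

lemma regular_play_exists:
  assumes "regular p" "legal_strategy \<sigma>" "legal_strategy \<tau>"
  shows "\<exists>ps. complete_play p ps \<and> follows \<sigma> 0 ps \<and> follows \<tau> 1 ps"
  using assms
proof (induction p arbitrary: \<sigma> \<tau> rule: measure_induct_rule[of total_weight])
  case (less p)
  show ?case
  proof (cases "game_over p")
    case True
    then have "complete_play p [p] \<and> follows \<sigma> 0 [p] \<and> follows \<tau> 1 [p]"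
      by (simp add: complete_play_singleton follows_def)
    then show ?thesis by blast
  next
    case False
    then obtain q where "vmove p q"
      using less.prems(1) regular_vmove_exists by blast
    then have m: "vmove p (\<sigma> p)"
      using less.prems(2) unfolding legal_strategy_def by blast
    have "finite (pverts (fst p))"
      using less.prems(1) by (cases p) simp
    then have "total_weight (\<sigma> p) < total_weight p"
      by (rule total_weight_vmove[OF m])
    then obtain ps where ps: "complete_play (\<sigma> p) ps" "follows \<tau> 0 ps" "follows \<sigma> 1 ps"
      using less.IH[OF _ regular_vmove[OF m less.prems(1)] less.prems(3,2)] by blast
    then obtain qs where "ps = \<sigma> p # qs"
      by (cases ps) (simp_all add: complete_play_def)
    with ps m have "complete_play p (p # ps) \<and> follows \<sigma> 0 (p # ps) \<and> follows \<tau> 1 (p # ps)"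
      by (simp add: complete_play_Cons follows_0_Cons follows_1_Cons del: One_nat_def)
    then show ?thesis by blast
  qed
qed

text \<open>Two winning strategies played against each other would yield a complete play won by both
  players.\<close>

lemma regular_not_misere_P_and_N:
  assumes "regular p"
  shows "\<not> (misere_P p \<and> misere_N p)"
proof
  assume "misere_P p \<and> misere_N p"
  then obtain \<sigma> \<tau> where
    \<sigma>: "legal_strategy \<sigma>" "\<And>ps. complete_play p ps \<Longrightarrow> follows \<sigma> 1 ps \<Longrightarrow> misere_won_by_second ps" and
    \<tau>: "legal_strategy \<tau>" "\<And>ps. complete_play p ps \<Longrightarrow> follows \<tau> 0 ps \<Longrightarrow> \<not> misere_won_by_second ps"
    unfolding misere_P_def misere_N_def by blast
  then show False
    using regular_play_exists[OF assms \<tau>(1) \<sigma>(1)] by blast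
qed

subsection \<open>Labellings\<close>

text \<open>\<open>labelling A H P N\<close>: peeling off sink components one after the other, starting from the set
  \<open>H\<close> of vertices of weight at least 2, has so far labelled \<open>P\<close> as losing and \<open>N\<close> as winning.  In
  the odd case only some of the predecessors of \<open>C\<close> need to be labelled, which makes the notion
  stable under contraction of unlabelled vertices.\<close>

inductive labelling :: "('a \<times> 'a) set \<Rightarrow> 'a set \<Rightarrow> 'a set \<Rightarrow> 'a set \<Rightarrow> bool"
  for A :: "('a \<times> 'a) set" and H :: "'a set" where
  heavy: "labelling A H {} H"
| odd: "\<lbrakk> labelling A H P N; finite C; odd (card C); strong_on A C; A `` C \<subseteq> C \<union> N;
    C \<inter> (P \<union> N) = {}; X \<inter> (P \<union> N \<union> C) = {}; \<forall>x\<in>X. A `` {x} \<inter> C \<noteq> {} \<rbrakk>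
    \<Longrightarrow> labelling A H (P \<union> C) (N \<union> X)"
| even: "\<lbrakk> labelling A H P N; finite C; even (card C); strong_on A C; A `` C \<subseteq> C \<union> N;
    C \<inter> (P \<union> N) = {} \<rbrakk>
    \<Longrightarrow> labelling A H P (N \<union> C)"

lemma labelling_heavy_subset: "labelling A H P N \<Longrightarrow> H \<subseteq> N"
  by (induction rule: labelling.induct) auto

lemma strong_on_contract_vertex_notin:
  "strong_on (parcs G) C \<Longrightarrow> u \<notin> C \<Longrightarrow> strong_on (parcs (contract_vertex G u)) C"
  using strong_on_contract_vertex[of G C u] by simp

text \<open>An arc is created only for predecessors of \<open>u\<close>, and a component
  \<open>C\<close> has no arc to \<open>u\<close>, since its arcs stay in \<open>C\<close> or enter
  \<open>N\<close>. Vertices of \<open>X\<close> may gain arcs, but keep theirs into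
  \<open>C\<close>.\<close>

lemma labelling_contract_vertex:
  "labelling (parcs G) H P N \<Longrightarrow> u \<notin> P \<union> N \<Longrightarrow> labelling (parcs (contract_vertex G u)) H P N"
proof (induction rule: labelling.induct)
  case heavy
  show ?case by (rule labelling.heavy)
next
  case (odd P N C X)
  show ?case
  proof (rule labelling.odd)
    show "\<forall>x\<in>X. parcs (contract_vertex G u) `` {x} \<inter> C \<noteq> {}"
    proof
      fix x assume "x \<in> X"
      with odd obtain c where "(x, c) \<in> parcs G" "c \<in> C" by blast
      with odd \<open>x \<in> X\<close> show "parcs (contract_vertex G u) `` {x} \<inter> C \<noteq> {}"
        by (auto simp: parcs_contract_vertex)
    qed
    show "strong_on (parcs (contract_vertex G u)) C"
      using odd by (intro strong_on_contract_vertex_notin) auto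
  qed (use odd in \<open>auto simp: parcs_contract_vertex\<close>)
next
  case (even P N C)
  show ?case
  proof (rule labelling.even)
    show "strong_on (parcs (contract_vertex G u)) C"
      using even by (intro strong_on_contract_vertex_notin) auto
  qed (use even in \<open>auto simp: parcs_contract_vertex\<close>)
qed

text \<open>Lowering the weight of the current vertex to 1 and staying there by the loop passes exactly
  the removing moves on to the opponent.\<close>

lemma wins_heavy:
  assumes "finite (pverts G)" "u \<in> pverts G" "(u, u) \<in> parcs G" "1 < w u"
  shows "wins (G, w, u)"
proof (cases "\<exists>q. vmove (G, w, u) q \<and> loses q")
  case True
  then show ?thesis using wins_move by blast
next
  case False
  have m: "vmove (G, w, u) (G, w(u := 1), u)"
    using assms by (intro vmove.decrease) auto
  have "loses (G, w(u := 1), u)"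
  proof (rule losesI)
    show "\<not> game_over (G, w(u := 1), u)"
      using assms by (auto simp: game_over_def)
  next
    fix q assume "vmove (G, w(u := 1), u) q"
    then have "vmove (G, w, u) q"
    proof cases
      case (remove v)
      then show ?thesis using assms vmove.remove[of u G w v] by simp
    next
      case remove_last
      then show ?thesis using assms vmove.remove_last[of G u w] by simp
    qed auto
    with False show "wins q"
      using assms finite_vmove wins_or_loses by (metis fst_conv)
  qed
  with m show ?thesis by (rule wins_move)
qed

text \<open>The outer induction is on the total weight, the inner one follows the stages of the
  labelling; only the stage that labels \<open>u\<close> itself is of interest. Generality in
  \<open>P\<close> and \<open>N\<close> lets the outer hypothesis be used for a labelling of the
  contracted graph that ends with the stage for \<open>C - {u}\<close>.\<close>

lemma labelling_sound:
  assumes "regular (G, w, u)" "pverts G \<noteq> {}" "labelling (parcs G) {v \<in> pverts G. 1 < w v} P N"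
  shows "(u \<in> P \<longrightarrow> loses (G, w, u)) \<and> (u \<in> N \<longrightarrow> wins (G, w, u))"
  using assms
proof (induction "sum w (pverts G)" arbitrary: G w u P N rule: less_induct)
  case less
  let ?H = "{v \<in> pverts G. 1 < w v}"
  let ?G = "contract_vertex G u"
  have u: "u \<in> pverts G" "finite (pverts G)" "0 < w u" "(u, u) \<in> parcs G"
    using less.prems(1,2) by auto
  \<comment> \<open>The outer hypothesis after removal of \<open>u\<close>. Since \<open>u\<close>
    has weight 1, the set of heavy vertices is the same before and after.\<close>
  have smaller: "(v \<in> P' \<longrightarrow> loses (?G, w(u := 0), v)) \<and> (v \<in> N' \<longrightarrow> wins (?G, w(u := 0), v))"
    if v: "(u, v) \<in> parcs G" "v \<noteq> u" and lab: "labelling (parcs ?G) ?H P' N'" and "u \<notin> ?H" for v P' N'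
  proof (rule less.hyps)
    have m: "vmove (G, w, u) (?G, w(u := 0), v)"
      using u v by (intro vmove.remove) auto
    then show "sum (w(u := 0)) (pverts ?G) < sum w (pverts G)"
      using total_weight_vmove[OF m] u(2) by simp
    show "regular (?G, w(u := 0), v)"
      using m less.prems(1) by (rule regular_vmove)
    show "pverts ?G \<noteq> {}"
      using v less.prems(1) by (auto simp: contract_vertex_def)
    have "{x \<in> pverts ?G. 1 < (w(u := 0)) x} = ?H"
      using \<open>u \<notin> ?H\<close> by (auto simp: contract_vertex_def)
    then show "labelling (parcs ?G) {x \<in> pverts ?G. 1 < (w(u := 0)) x} P' N'"
      using lab by simp
  qed
  have rem: "vmove (G, w, u) (?G, w(u := 0), v)" if "(u, v) \<in> parcs G" "v \<noteq> u" for v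
    using u that by (intro vmove.remove) auto
  \<comment> \<open>Deleting the current vertex of a sink component leaves a sink component of other parity.\<close>
  have shrink: "strong_on (parcs ?G) (C - {u})" "parcs ?G `` (C - {u}) \<subseteq> (C - {u}) \<union> N"
    if "strong_on (parcs G) C" "parcs G `` C \<subseteq> C \<union> N" "u \<in> C" for C N
    using that(2,3) strong_on_contract_vertex[OF that(1)] by (auto simp: parcs_contract_vertex)
  show ?case
    using less.prems(3)
  proof (induction rule: labelling.induct)
    case heavy
    then show ?case
      using wins_heavy[of G u w] u by simp
  next
    case (odd P N C X)
    have H: "?H \<subseteq> N"
      using odd.hyps(1) by (rule labelling_heavy_subset)
    show ?case
    proof (cases "u \<in> P \<union> N")
      case True
      with odd.IH odd.hyps(6,7) show ?thesis by blast
    next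
      case False
      note lab = labelling_contract_vertex[OF odd.hyps(1) False]
      have "u \<notin> ?H"
        using False H by auto
      have "loses (G, w, u)" if "u \<in> C"
      proof (rule losesI)
        show "\<not> game_over (G, w, u)"
          using u by (auto simp: game_over_def)
      next
        fix q assume "vmove (G, w, u) q"
        then show "wins q"
        proof cases
          case (decrease k v)
          then show ?thesis using \<open>u \<notin> ?H\<close> by auto
        next
          case (remove v)
          have "card (C - {u}) = card C - 1" "0 < card C"
            using odd.hyps(2) that by (auto simp: card_gt_0_iff)
          \<comment> \<open>If \<open>C = {u}\<close>, the even component added here is empty, and
            every possible \<open>v\<close> lies in \<open>N\<close>.\<close>
          then have "labelling (parcs ?G) ?H P (N \<union> (C - {u}))"
            using odd.hyps(2,3,6) shrink[OF odd.hyps(4,5) that]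
            by (intro labelling.even[OF lab]) auto
          moreover have "v \<in> N \<union> (C - {u})"
            using remove odd.hyps(5) that by auto
          ultimately show ?thesis
            using smaller[OF remove(4,5) _ \<open>u \<notin> ?H\<close>] remove(1) by simp
        next
          \<comment> \<open>The misere rule enters here: the opponent faces the empty graph and has
            won.\<close>
          case remove_last
          then show ?thesis
            by (auto intro!: wins_over simp: game_over_def contract_vertex_def)
        qed
      qed
      moreover have "wins (G, w, u)" if uX: "u \<in> X"
      proof -
        have "u \<notin> C"
          using odd.hyps(7) uX by blast
        obtain c where c: "(u, c) \<in> parcs G" "c \<in> C"
          using odd.hyps(8) uX by blast
        have "strong_on (parcs ?G) C"
          using odd.hyps(4) \<open>u \<notin> C\<close> by (rule strong_on_contract_vertex_notin)
        \<comment> \<open>Here \<open>X\<close> is taken empty: only the labels of \<open>C\<close>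
          matter for the move to \<open>c\<close>, and \<open>u\<close>, itself in the old
          \<open>X\<close>, is gone.\<close>
        then have "labelling (parcs ?G) ?H (P \<union> C) (N \<union> {})"
          using odd.hyps(2,3,5,6) \<open>u \<notin> C\<close> False
          by (intro labelling.odd[OF lab]) (auto simp: parcs_contract_vertex)
        then have "loses (?G, w(u := 0), c)"
          using smaller[OF c(1) _ _ \<open>u \<notin> ?H\<close>] c(2) \<open>u \<notin> C\<close> by auto
        moreover have "vmove (G, w, u) (?G, w(u := 0), c)"
          using rem[OF c(1)] c(2) \<open>u \<notin> C\<close> by auto
        ultimately show ?thesis by (intro wins_move)
      qed
      ultimately show ?thesis using False by blast
    qed
  next
    case (even P N C)
    have H: "?H \<subseteq> N"
      using even.hyps(1) by (rule labelling_heavy_subset)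
    show ?case
    proof (cases "u \<in> P \<union> N \<or> u \<notin> C")
      case True
      with even.IH even.hyps(6) show ?thesis by blast
    next
      case False
      then have uC: "u \<in> C" and "u \<notin> P \<union> N" by auto
      note lab = labelling_contract_vertex[OF even.hyps(1) this(2)]
      have "u \<notin> ?H"
        using False H by auto
      have "C \<noteq> {u}"
        using even.hyps(3) by auto
      then obtain y where "y \<in> C" "u \<noteq> y"
        using uC by blast
      then obtain c where c: "(u, c) \<in> parcs G" "c \<in> C" "c \<noteq> u"
        using even.hyps(4) uC strong_on_successor[of "parcs G" C u y] by blast
      have "card (C - {u}) = card C - 1" "0 < card C"
        using even.hyps(2) uC by (auto simp: card_gt_0_iff)
      then have "labelling (parcs ?G) ?H (P \<union> (C - {u})) (N \<union> {})"
        using even.hyps(2,3,6) shrink[OF even.hyps(4,5) uC]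
        by (intro labelling.odd[OF lab]) auto
      then have "loses (?G, w(u := 0), c)"
        using smaller[OF c(1,3) _ \<open>u \<notin> ?H\<close>] c(2,3) by auto
      then have "wins (G, w, u)"
        by (rule wins_move[OF rem[OF c(1,3)]])
      with False show ?thesis by blast
    qed
  qed
qed

lemma vertexnim_inst_regular:
  assumes "vertexnim_inst G w u" "\<forall>v \<in> pverts G. (v, v) \<in> parcs G"
  shows "regular (G, w, u)"
proof -
  interpret pair_fin_digraph G
    using assms by (simp add: vertexnim_inst_def)
  have sub: "parcs G \<subseteq> pverts G \<times> pverts G"
    using arc_fst_in_verts arc_snd_in_verts by fastforce
  have "(x, y) \<in> (parcs G)\<^sup>*" if "x \<in> pverts G" "y \<in> pverts G" for x y
  proof -
    have "x \<rightarrow>\<^sup>*\<^bsub>with_proj G\<^esub> y"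
      using assms that by (auto simp: vertexnim_inst_def strongly_connected_def)
    then have "(x, y) \<in> (arcs_ends (with_proj G))\<^sup>*"
      unfolding reachable_def by (rule rtrancl_on_rtranclI)
    then show ?thesis by simp
  qed
  moreover have "parcs G \<inter> pverts G \<times> pverts G = parcs G"
    using sub by blast
  ultimately show ?thesis
    using assms sub by (auto simp: vertexnim_inst_def strong_on_def)
qed

subsection \<open>Weakest preconditions with time credits\<close>

text \<open>The postcondition receives the credits left over, so savings in one part can pay for a
  later one. As \<open>exec\<close> is deterministic, the existential expresses total
  correctness.\<close>

definition wp :: "cmd \<Rightarrow> (nat \<Rightarrow> memory \<Rightarrow> bool) \<Rightarrow> nat \<Rightarrow> memory \<Rightarrow> bool" where
  "wp c Q k s \<longleftrightarrow> (\<exists>t s'. exec c s t s' \<and> t \<le> k \<and> Q (k - t) s')"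

lemma wp_Skip: "wp Skip Q k s \<longleftrightarrow> 1 \<le> k \<and> Q (k - 1) s"
proof -
  have "exec Skip s t s' \<longleftrightarrow> t = 1 \<and> s' = s" for t s'
    using exec.Skip exec_deterministic by blast
  then show ?thesis
    unfolding wp_def by auto
qed

lemma wp_Assign:
  "wp (Assign a i e) Q k s \<longleftrightarrow> 1 + expr_time i + expr_time e \<le> k \<and>
     Q (k - (1 + expr_time i + expr_time e)) (s(a := (s a)(expr_val i s := expr_val e s)))"
  (is "_ \<longleftrightarrow> ?t \<le> k \<and> Q _ ?s")
proof -
  have "exec (Assign a i e) s t s' \<longleftrightarrow> t = ?t \<and> s' = ?s" for t s'
    using exec.Assign exec_deterministic by blast
  then show ?thesis
    unfolding wp_def by auto
qed

lemma wp_Seq: "wp (Seq c d) Q k s \<longleftrightarrow> wp c (wp d Q) k s"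
proof
  assume "wp (Seq c d) Q k s"
  then obtain t s'' where *: "exec (Seq c d) s t s''" "t \<le> k" "Q (k - t) s''"
    unfolding wp_def by blast
  from *(1) obtain t1 s' t2 where "exec c s t1 s'" "exec d s' t2 s''" "t = t1 + t2"
    by cases
  moreover from this * have "t1 \<le> k" "t2 \<le> k - t1" "Q (k - t1 - t2) s''"
    by auto
  ultimately show "wp c (wp d Q) k s"
    unfolding wp_def by blast
next
  assume "wp c (wp d Q) k s"
  then obtain t1 s' t2 s'' where *: "exec c s t1 s'" "t1 \<le> k"
    "exec d s' t2 s''" "t2 \<le> k - t1" "Q (k - t1 - t2) s''"
    unfolding wp_def by blast
  with exec.Seq[OF *(1,3)] show "wp (Seq c d) Q k s"
    unfolding wp_def by (intro exI[of _ "t1 + t2"] exI[of _ s'']) auto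
qed

lemma wp_IfNz:
  assumes "1 + expr_time b \<le> k"
    and "expr_val b s \<noteq> 0 \<Longrightarrow> wp c Q (k - (1 + expr_time b)) s"
    and "expr_val b s = 0 \<Longrightarrow> wp d Q (k - (1 + expr_time b)) s"
  shows "wp (IfNz b c d) Q k s"
proof (cases "expr_val b s = 0")
  case True
  with assms obtain t s' where *: "exec d s t s'" "t \<le> k - (1 + expr_time b)"
    "Q (k - (1 + expr_time b) - t) s'"
    unfolding wp_def by blast
  with exec.IfFalse[OF True *(1)] assms(1) show ?thesis
    unfolding wp_def by (intro exI[of _ "1 + expr_time b + t"] exI[of _ s']) auto
next
  case False
  with assms obtain t s' where *: "exec c s t s'" "t \<le> k - (1 + expr_time b)"
    "Q (k - (1 + expr_time b) - t) s'"
    unfolding wp_def by blast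
  with exec.IfTrue[OF False *(1)] assms(1) show ?thesis
    unfolding wp_def by (intro exI[of _ "1 + expr_time b + t"] exI[of _ s']) auto
qed

lemma wp_mono:
  assumes "wp c Q k s" and "\<And>k' s'. Q k' s' \<Longrightarrow> R k' s'"
  shows "wp c R k s"
  using assms unfolding wp_def by blast

text \<open>A frame rule: \<open>d\<close> credits set aside survive the run. The conjunct
  \<open>d \<le> k'\<close> makes the truncated subtraction exact.\<close>

lemma wp_add:
  assumes "wp c Q k s"
  shows "wp c (\<lambda>k' s'. d \<le> k' \<and> Q (k' - d) s') (k + d) s"
proof -
  obtain t s' where "exec c s t s'" "t \<le> k" "Q (k - t) s'"
    using assms unfolding wp_def by blast
  then show ?thesis
    unfolding wp_def by (intro exI[of _ t] exI[of _ s']) auto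
qed

text \<open>No separate termination measure is needed, because every iteration uses up credits.\<close>

lemma wp_WhileNz:
  assumes "I k s"
    and step: "\<And>k s. I k s \<Longrightarrow> expr_val b s \<noteq> 0 \<Longrightarrow>
      1 + expr_time b \<le> k \<and> wp c I (k - (1 + expr_time b)) s"
    and stop: "\<And>k s. I k s \<Longrightarrow> expr_val b s = 0 \<Longrightarrow>
      1 + expr_time b \<le> k \<and> Q (k - (1 + expr_time b)) s"
  shows "wp (WhileNz b c) Q k s"
  using assms(1)
proof (induction k arbitrary: s rule: less_induct)
  case (less k)
  let ?b = "1 + expr_time b"
  show ?case
  proof (cases "expr_val b s = 0")
    case True
    with stop[OF less.prems] exec.WhileFalse[OF True, of c] show ?thesis
      unfolding wp_def by blast
  next
    case False
    with step[OF less.prems] obtain t s' where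
      *: "?b \<le> k" "exec c s t s'" "t \<le> k - ?b" "I (k - ?b - t) s'"
      unfolding wp_def by blast
    moreover have "k - ?b - t < k"
      using * by linarith
    ultimately obtain t' s'' where
      **: "exec (WhileNz b c) s' t' s''" "t' \<le> k - ?b - t" "Q (k - ?b - t - t') s''"
      using less.IH unfolding wp_def by blast
    from exec.WhileTrue[OF False *(2) **(1)] * ** show ?thesis
      unfolding wp_def by (intro exI[of _ "?b + t + t'"] exI[of _ s'']) auto
  qed
qed

section \<open>Variables, frame conditions and counting loops\<close>

abbreviation var :: "string \<Rightarrow> expr" where
  "var a \<equiv> Cell a (Num 0)"

abbreviation set_var :: "string \<Rightarrow> nat \<Rightarrow> memory \<Rightarrow> memory" where
  "set_var a x s \<equiv> s(a := (s a)(0 := x))"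

definition agree :: "string set \<Rightarrow> memory \<Rightarrow> memory \<Rightarrow> bool" where
  "agree X s s' \<longleftrightarrow> (\<forall>a. a \<notin> X \<longrightarrow> s' a = s a)"

lemma agree_refl: "agree X s s"
  by (simp add: agree_def)

lemma agreeD: "agree X s s' \<Longrightarrow> a \<notin> X \<Longrightarrow> s' a = s a"
  by (simp add: agree_def)

lemma agree_upd: "agree X s s' \<Longrightarrow> a \<in> X \<Longrightarrow> agree X s (s'(a := f))"
  by (auto simp: agree_def)

lemma agree_trans: "agree X s s' \<Longrightarrow> agree Y s' s'' \<Longrightarrow> Y \<subseteq> X \<Longrightarrow> agree X s s''"
  unfolding agree_def by (metis subsetD)

definition For :: "string \<Rightarrow> string \<Rightarrow> cmd \<Rightarrow> cmd" where
  "For v b c = Seq (Assign v (Num 0) (Num 0))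
     (WhileNz (Sub (var b) (var v)) (Seq c (Assign v (Num 0) (Add (var v) (Num 1)))))"

text \<open>Each iteration costs 6 for the test and 6 for the increment; 9 is 3 for initialising the
  counter plus 6 for the last test. The cost of the body is left to the credits in \<open>J\<close>,
  which permits amortisation over iterations.\<close>

lemma wp_For:
  assumes "v \<noteq> b" "s b 0 = N" "12 * N + 9 \<le> k" "J 0 (k - (12 * N + 9)) (set_var v 0 s)"
    and step: "\<And>i k s. i < N \<Longrightarrow> s v 0 = i \<Longrightarrow> s b 0 = N \<Longrightarrow> J i k s \<Longrightarrow>
      wp c (\<lambda>k s. s v 0 = i \<and> s b 0 = N \<and> J (Suc i) k (set_var v (Suc i) s)) k s"
    and stop: "\<And>k s. s b 0 = N \<Longrightarrow> J N k s \<Longrightarrow> Q k s"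
  shows "wp (For v b c) Q k s"
proof -
  define I where "I k s \<longleftrightarrow> s b 0 = N \<and> s v 0 \<le> N \<and> 12 * (N - s v 0) + 6 \<le> k \<and>
    J (s v 0) (k - (12 * (N - s v 0) + 6)) s" for k s
  have "wp (WhileNz (Sub (var b) (var v)) (Seq c (Assign v (Num 0) (Add (var v) (Num 1))))) Q
    (k - 3) (set_var v 0 s)"
  proof (rule wp_WhileNz[where I = I])
    have "k - 3 - (12 * N + 6) = k - (12 * N + 9)"
      by simp
    then show "I (k - 3) (set_var v 0 s)"
      using assms(1-4) by (auto simp: I_def)
  next
    fix k s assume I: "I k s" and "expr_val (Sub (var b) (var v)) s \<noteq> 0"
    then have i: "s v 0 < N" and k: "12 * (N - s v 0) + 6 \<le> k"
      by (auto simp: I_def)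
    let ?i = "s v 0"
    \<comment> \<open>The credits to be carried through the body: 6 for this increment and
      \<open>12 * (N - Suc ?i) + 6\<close> for the invariant afterwards.\<close>
    define d where "d = 12 * (N - Suc ?i) + 12"
    have d: "12 * (N - ?i) + 6 = d + 6" "d \<ge> 12"
      using i by (auto simp: d_def)
    have "wp c (\<lambda>k' s'. d \<le> k' \<and> (s' v 0 = ?i \<and> s' b 0 = N \<and> J (Suc ?i) (k' - d) (set_var v (Suc ?i) s')))
      (k - (d + 6) + d) s"
      using I i d by (intro wp_add step) (auto simp: I_def)
    moreover have "k - (d + 6) + d = k - 6"
      using k d by simp
    ultimately have "wp c (\<lambda>k' s'. d \<le> k' \<and> (s' v 0 = ?i \<and> s' b 0 = N \<and>
      J (Suc ?i) (k' - d) (set_var v (Suc ?i) s'))) (k - 6) s"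
      by simp
    then have "wp c (wp (Assign v (Num 0) (Add (var v) (Num 1))) I) (k - 6) s"
    proof (rule wp_mono)
      fix k' s' assume *: "d \<le> k' \<and> (s' v 0 = ?i \<and> s' b 0 = N \<and> J (Suc ?i) (k' - d) (set_var v (Suc ?i) s'))"
      moreover have "k' - 6 - (12 * (N - Suc ?i) + 6) = k' - d"
        by (simp add: d_def)
      ultimately show "wp (Assign v (Num 0) (Add (var v) (Num 1))) I k' s'"
        using \<open>v \<noteq> b\<close> i d by (auto simp: wp_Assign I_def d_def)
    qed
    moreover have "1 + expr_time (Sub (var b) (var v)) = 6"
      by simp
    ultimately show "1 + expr_time (Sub (var b) (var v)) \<le> k \<and>
      wp (Seq c (Assign v (Num 0) (Add (var v) (Num 1)))) I (k - (1 + expr_time (Sub (var b) (var v)))) s"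
      using k d unfolding wp_Seq by presburger
  next
    fix k s assume I: "I k s" and "expr_val (Sub (var b) (var v)) s = 0"
    then have "s v 0 = N"
      by (auto simp: I_def)
    with I stop have "6 \<le> k \<and> Q (k - 6) s"
      by (auto simp: I_def)
    moreover have "1 + expr_time (Sub (var b) (var v)) = 6"
      by simp
    ultimately show "1 + expr_time (Sub (var b) (var v)) \<le> k \<and>
      Q (k - (1 + expr_time (Sub (var b) (var v)))) s"
      by presburger
  qed
  then show ?thesis
    using assms(3) by (simp add: For_def wp_Seq wp_Assign numeral_3_eq_3)
qed

lemma wp_For_const:
  assumes "v \<noteq> b" "s b 0 = N" "(B + 12) * N + 9 \<le> k" "J 0 (set_var v 0 s)"
    and step: "\<And>i s. i < N \<Longrightarrow> s v 0 = i \<Longrightarrow> s b 0 = N \<Longrightarrow> J i s \<Longrightarrow>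
      wp c (\<lambda>k s. s v 0 = i \<and> s b 0 = N \<and> J (Suc i) (set_var v (Suc i) s)) B s"
    and stop: "\<And>k' s. s b 0 = N \<Longrightarrow> J N s \<Longrightarrow> k - ((B + 12) * N + 9) \<le> k' \<Longrightarrow> Q k' s"
  shows "wp (For v b c) Q k s"
proof (rule wp_For[where J = "\<lambda>i k' s. J i s \<and> k - ((B + 12) * N + 9) + B * (N - i) \<le> k'"])
  show "J 0 (set_var v 0 s) \<and> k - ((B + 12) * N + 9) + B * (N - 0) \<le> k - (12 * N + 9)"
    using assms(3,4) by (simp add: algebra_simps)
next
  fix i k' s
  assume i: "i < N" "s v 0 = i" "s b 0 = N"
    and J: "J i s \<and> k - ((B + 12) * N + 9) + B * (N - i) \<le> k'"
  have "B * (N - i) = B * (N - Suc i) + B"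
    using i(1) by (metis Suc_diff_Suc mult_Suc_right add.commute)
  moreover have "wp c (\<lambda>k'' s'. k' - B \<le> k'' \<and> (s' v 0 = i \<and> s' b 0 = N \<and> J (Suc i) (set_var v (Suc i) s')))
    (B + (k' - B)) s"
    using i J by (intro wp_add step) auto
  ultimately show "wp c (\<lambda>k'' s'. s' v 0 = i \<and> s' b 0 = N \<and> J (Suc i) (set_var v (Suc i) s') \<and>
    k - ((B + 12) * N + 9) + B * (N - Suc i) \<le> k'') k' s"
    using J by (auto elim: wp_mono)
next
  show "12 * N + 9 \<le> k"
    using assms(3) by (simp add: algebra_simps)
qed (use assms in auto)

subsection \<open>Adjacency lists\<close>

fun chain :: "(nat \<Rightarrow> nat) \<Rightarrow> nat \<Rightarrow> nat list \<Rightarrow> bool" where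
  "chain nx e [] \<longleftrightarrow> e = 0"
| "chain nx e (j # js) \<longleftrightarrow> e = Suc j \<and> chain nx (nx j) js"

lemma chain_upd: "chain nx e js \<Longrightarrow> j \<notin> set js \<Longrightarrow> chain (nx(j := x)) e js"
  by (induction js arbitrary: e) auto

text \<open>\<open>h v\<close> is the head and \<open>x\<close> the successor function of a linked list, with entries shifted by one
  so that 0 is the end, of the indices \<open>j < m\<close> with \<open>a j = v\<close>.\<close>

definition indexed :: "(nat \<Rightarrow> nat) \<Rightarrow> (nat \<Rightarrow> nat) \<Rightarrow> (nat \<Rightarrow> nat) \<Rightarrow> nat \<Rightarrow> bool" where
  "indexed h x a m \<longleftrightarrow>
     (\<forall>v. \<exists>js. chain x (h v) js \<and> distinct js \<and> set js = {j. j < m \<and> a j = v})"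

text \<open>Index \<open>m\<close> is put in front of the list for \<open>a m\<close>. Cell
  \<open>m\<close> of \<open>x\<close> occurs in no earlier list, so all other chains survive the
  write.\<close>

lemma indexed_Suc:
  assumes "indexed h x a m"
  shows "indexed (h(a m := Suc m)) (x(m := h (a m))) a (Suc m)"
  unfolding indexed_def
proof
  fix v
  obtain js where js: "chain x (h v) js" "distinct js" "set js = {j. j < m \<and> a j = v}"
    using assms unfolding indexed_def by blast
  have c: "chain (x(m := h (a m))) (h v) js"
    using js by (intro chain_upd) auto
  show "\<exists>js. chain (x(m := h (a m))) ((h(a m := Suc m)) v) js \<and> distinct js \<and>
    set js = {j. j < Suc m \<and> a j = v}"
  proof (cases "a m = v")
    case True
    have "set (m # js) = {j. j < Suc m \<and> a j = v}"
      using js(3) True by (simp add: set_eq_iff less_Suc_eq) blast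
    moreover have "chain (x(m := h (a m))) ((h(a m := Suc m)) v) (m # js)" "distinct (m # js)"
      using c js(2,3) True by simp_all
    ultimately show ?thesis by blast
  next
    case False
    have "set js = {j. j < Suc m \<and> a j = v}"
      using js(3) False by (simp add: set_eq_iff less_Suc_eq) blast
    moreover have "chain (x(m := h (a m))) ((h(a m := Suc m)) v) js"
      using c False by simp
    ultimately show ?thesis using js(2) by blast
  qed
qed

definition index_arcs :: "string \<Rightarrow> string \<Rightarrow> string \<Rightarrow> cmd" where
  "index_arcs h x a = For ''j'' ''m'' (Seq
     (Assign x (var ''j'') (Cell h (Cell a (var ''j''))))
     (Assign h (Cell a (var ''j'')) (Add (var ''j'') (Num 1))))"

lemma wp_index_arcs:
  assumes names: "distinct [h, x, a, ''j'', ''m'']"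
    and "s h = (\<lambda>_. 0)" "s ''m'' 0 = m" "31 * m + 9 \<le> k"
    and post: "\<And>k' s'. agree {h, x, ''j''} s s' \<Longrightarrow> indexed (s' h) (s' x) (s a) m \<Longrightarrow>
      k - (31 * m + 9) \<le> k' \<Longrightarrow> Q k' s'"
  shows "wp (index_arcs h x a) Q k s"
  unfolding index_arcs_def
proof (rule wp_For_const[where B = 19 and N = m and
      J = "\<lambda>i s'. agree {h, x, ''j''} s s' \<and> indexed (s' h) (s' x) (s a) i"])
  fix i s' assume s': "s' ''j'' 0 = i" "s' ''m'' 0 = m"
    "agree {h, x, ''j''} s s' \<and> indexed (s' h) (s' x) (s a) i"
  then have "s' a = s a"
    using names by (auto intro: agreeD)
  moreover have "agree {h, x, ''j''} s (s'(x := f, h := g, ''j'' := l))" for f g l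
    using s' by (simp add: agree_upd)
  moreover have ne: "h \<noteq> x" "a \<noteq> h" "a \<noteq> x" "h \<noteq> ''j''" "h \<noteq> ''m''" "x \<noteq> ''j''" "x \<noteq> ''m''"
    using names by auto
  ultimately show "wp (Seq (Assign x (var ''j'') (Cell h (Cell a (var ''j''))))
     (Assign h (Cell a (var ''j'')) (Add (var ''j'') (Num 1))))
     (\<lambda>k s'. s' ''j'' 0 = i \<and> s' ''m'' 0 = m \<and> agree {h, x, ''j''} s (set_var ''j'' (Suc i) s') \<and>
       indexed ((set_var ''j'' (Suc i) s') h) ((set_var ''j'' (Suc i) s') x) (s a) (Suc i)) 19 s'"
    using s' by (simp add: wp_Seq wp_Assign ne[symmetric] indexed_Suc)
next
  have "indexed (\<lambda>_. 0) f (s a) 0" for f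
    unfolding indexed_def by (auto intro!: exI[of _ "[]"])
  then show "agree {h, x, ''j''} s (set_var ''j'' 0 s) \<and>
    indexed ((set_var ''j'' 0 s) h) ((set_var ''j'' 0 s) x) (s a) 0"
    using names assms(2) by (simp add: agree_upd agree_refl)
next
  fix k' s' assume "agree {h, x, ''j''} s s' \<and> indexed (s' h) (s' x) (s a) m"
    "k - ((19 + 12) * m + 9) \<le> k'"
  then show "Q k' s'"
    by (intro post) simp_all
qed (use assms in simp_all)

subsection \<open>Graph search\<close>

definition visit :: "string \<Rightarrow> cmd" where
  "visit d = IfNz (Cell ''mk'' (Cell d (Sub (var ''e'') (Num 1))))
     Skip
     (Seq (Assign ''mk'' (Cell d (Sub (var ''e'') (Num 1))) (Num 1))
     (Seq (Assign ''q'' (var ''qt'') (Cell d (Sub (var ''e'') (Num 1))))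
     (Assign ''qt'' (Num 0) (Add (var ''qt'') (Num 1)))))"

definition follow :: "string \<Rightarrow> cmd" where
  "follow x = Assign ''e'' (Num 0) (Cell x (Sub (var ''e'') (Num 1)))"

definition scan :: "string \<Rightarrow> string \<Rightarrow> cmd" where
  "scan x d = WhileNz (var ''e'') (Seq (visit d) (follow x))"

text \<open>\<open>qh\<close> is advanced before the scan, so the vertex being scanned already
  counts as processed; this is why \<open>searching\<close> has a set of pending successors.\<close>

definition drain :: "string \<Rightarrow> string \<Rightarrow> string \<Rightarrow> cmd" where
  "drain h x d = WhileNz (Sub (var ''qt'') (var ''qh''))
     (Seq (Assign ''e'' (Num 0) (Cell h (Cell ''q'' (var ''qh''))))
     (Seq (Assign ''qh'' (Num 0) (Add (var ''qh'') (Num 1)))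
     (scan x d)))"

text \<open>\<open>deg\<close> is the list length and serves the time accounting only. Forward and
  backward searches both fit: \<open>d\<close> gives the far ends of the arcs in the chosen
  direction.\<close>

definition adjacency ::
  "(nat \<Rightarrow> nat) \<Rightarrow> (nat \<Rightarrow> nat) \<Rightarrow> (nat \<Rightarrow> nat) \<Rightarrow> nat \<Rightarrow> (nat \<times> nat) set \<Rightarrow> (nat \<Rightarrow> nat) \<Rightarrow> bool" where
  "adjacency h x d n E deg \<longleftrightarrow>
     (\<forall>v<n. \<exists>js. chain x (h v) js \<and> d ` set js = E `` {v} \<and> length js = deg v)"

text \<open>A search of the graph \<open>E\<close> on \<open>{..<n}\<close> outside \<open>M\<close>.  The queue holds the vertices found so far in
  the cells \<open>q i\<close> with \<open>i < qt\<close>; those with \<open>i < qh\<close> have been processed, except that successors in \<open>W\<close>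
  are still pending.  The set \<open>Z\<close> is an upper bound for what can be found.\<close>

definition searching :: "(nat \<times> nat) set \<Rightarrow> nat \<Rightarrow> nat set \<Rightarrow> nat set \<Rightarrow> nat set \<Rightarrow>
    (nat \<Rightarrow> nat) \<Rightarrow> (nat \<Rightarrow> nat) \<Rightarrow> nat \<Rightarrow> nat \<Rightarrow> bool" where
  "searching E n M Z W mk q qh qt \<longleftrightarrow>
     qh \<le> qt \<and> inj_on q {..<qt} \<and> q ` {..<qt} \<subseteq> {..<n} \<inter> Z - M \<and>
     (\<forall>y<n. mk y \<noteq> 0 \<longleftrightarrow> y \<in> M \<union> q ` {..<qt}) \<and>
     (\<forall>i<qh. \<forall>y. (q i, y) \<in> E \<longrightarrow> mk y \<noteq> 0 \<or> y \<in> W) \<and>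
     W \<subseteq> {..<n} \<inter> (Z \<union> M)"

lemma searching_push:
  assumes "searching E n M Z W mk q qh qt" "mk y = 0" "y < n" "y \<in> Z"
  shows "searching E n M Z W (mk(y := 1)) (q(qt := y)) qh (Suc qt)"
proof -
  have y: "y \<notin> M \<union> q ` {..<qt}"
    using assms by (auto simp: searching_def)
  have im: "(q(qt := y)) ` {..<Suc qt} = insert y (q ` {..<qt})"
    by (auto simp: lessThan_Suc)
  have inj: "inj_on (q(qt := y)) {..<Suc qt}"
    using assms(1) y by (auto simp: searching_def lessThan_Suc inj_on_def)
  show ?thesis
    using assms y inj unfolding searching_def im by auto
qed

lemma searching_pop:
  assumes "searching E n M Z {} mk q qh qt" "qh < qt" "E \<subseteq> {..<n} \<times> {..<n}" "E `` Z \<subseteq> Z \<union> M"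
  shows "searching E n M Z (E `` {q qh}) mk q (Suc qh) qt"
proof -
  have "q qh \<in> Z"
    using assms(1,2) unfolding searching_def by blast
  then have "E `` {q qh} \<subseteq> {..<n} \<inter> (Z \<union> M)"
    using assms(3,4) by blast
  then show ?thesis
    using assms(1,2) unfolding searching_def less_Suc_eq by auto
qed

lemma searching_skip:
  "searching E n M Z (insert y W) mk q qh qt \<Longrightarrow> mk y \<noteq> 0 \<Longrightarrow> searching E n M Z W mk q qh qt"
  unfolding searching_def by blast

lemma searching_le: "searching E n M Z W mk q qh qt \<Longrightarrow> qt \<le> n"
proof -
  assume "searching E n M Z W mk q qh qt"
  then have "inj_on q {..<qt}" "q ` {..<qt} \<subseteq> {..<n}"
    by (auto simp: searching_def)
  then show "qt \<le> n"
    using card_inj_on_le[of q "{..<qt}" "{..<n}"] by simp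
qed

text \<open>A potential: each vertex not yet dequeued owns credits for its own processing and for
  its arc list. The weight 40 rounds up the true costs, at most 38 per arc and 21 per vertex. It
  does not restart with a new root, so many searches together remain linear.\<close>

definition search_credits :: "nat \<Rightarrow> (nat \<Rightarrow> nat) \<Rightarrow> (nat \<Rightarrow> nat) \<Rightarrow> nat \<Rightarrow> nat" where
  "search_credits n deg q qh = (\<Sum>v\<in>{..<n} - q ` {..<qh}. 40 + 40 * deg v)"

lemma search_credits_pop:
  assumes "searching E n M Z W mk q qh qt" "qh < qt"
  shows "search_credits n deg q qh = search_credits n deg q (Suc qh) + (40 + 40 * deg (q qh))"
proof -
  have "q qh \<noteq> q i" if "i < qh" for i
    using assms that inj_onD[of q "{..<qt}" qh i] by (auto simp: searching_def)
  moreover have "q qh < n"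
    using assms unfolding searching_def by blast
  ultimately have "q qh \<in> {..<n} - q ` {..<qh}"
    by auto
  moreover have "{..<n} - q ` {..<Suc qh} = {..<n} - q ` {..<qh} - {q qh}"
    by (auto simp: lessThan_Suc)
  ultimately show ?thesis
    by (simp add: search_credits_def sum.remove)
qed

lemma search_credits_push:
  "qh \<le> qt \<Longrightarrow> search_credits n deg (q(qt := y)) qh = search_credits n deg q qh"
proof -
  assume "qh \<le> qt"
  then have "(q(qt := y)) ` {..<qh} = q ` {..<qh}"
    by (intro image_cong) auto
  then show ?thesis
    by (simp add: search_credits_def)
qed

abbreviation search_vars :: "string set" where
  "search_vars \<equiv> {''mk'', ''q'', ''qh'', ''qt'', ''e''}"

lemma wp_drain:
  assumes names: "h \<notin> search_vars" "x \<notin> search_vars" "d \<notin> search_vars"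
    and adj: "adjacency (s h) (s x) (s d) n E deg"
    and E: "E \<subseteq> {..<n} \<times> {..<n}" and Z: "E `` Z \<subseteq> Z \<union> M"
    and init: "searching E n M Z {} (s ''mk'') (s ''q'') (s ''qh'' 0) (s ''qt'' 0)"
    and credits: "K + search_credits n deg (s ''q'') (s ''qh'' 0) + 6 \<le> k"
    and post: "\<And>k' s'. \<lbrakk> agree search_vars s s'; \<forall>y. s ''mk'' y \<noteq> 0 \<longrightarrow> s' ''mk'' y \<noteq> 0;
        s' ''qh'' 0 = s' ''qt'' 0;
        searching E n M Z {} (s' ''mk'') (s' ''q'') (s' ''qt'' 0) (s' ''qt'' 0);
        K + search_credits n deg (s' ''q'') (s' ''qt'' 0) \<le> k' \<rbrakk> \<Longrightarrow> Q k' s'"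
  shows "wp (drain h x d) Q k s"
proof -
  \<comment> \<open>\<open>W\<close> contains the successors still pending, \<open>c\<close> is what
    the rest of the current scan and the next test cost, and \<open>K\<close> is a reserve for the
    code after the loop.\<close>
  define Inv where "Inv W c k' s' \<longleftrightarrow> agree search_vars s s' \<and>
    (\<forall>y. s ''mk'' y \<noteq> 0 \<longrightarrow> s' ''mk'' y \<noteq> 0) \<and>
    searching E n M Z W (s' ''mk'') (s' ''q'') (s' ''qh'' 0) (s' ''qt'' 0) \<and>
    K + search_credits n deg (s' ''q'') (s' ''qh'' 0) + c \<le> k'" for W c k' and s' :: memory
  \<comment> \<open>40 credits per arc left in the list, and 9 = 3 + 6 for the final test of the
    scan and the next test of the outer loop.\<close>
  define Inner where "Inner k' s' \<longleftrightarrow> (\<exists>js. chain (s x) (s' ''e'' 0) js \<and>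
    Inv (s d ` set js) (9 + 40 * length js) k' s')" for k' and s' :: memory
  show ?thesis
    unfolding drain_def
  proof (rule wp_WhileNz[where I = "Inv {} 6"])
    show "Inv {} 6 k s"
      using init credits by (simp add: Inv_def agree_refl)
  next
    fix k' s' assume I: "Inv {} 6 k' s'" and b: "expr_val (Sub (var ''qt'') (var ''qh'')) s' \<noteq> 0"
    let ?v = "s' ''q'' (s' ''qh'' 0)"
    have lt: "s' ''qh'' 0 < s' ''qt'' 0"
      using b by simp
    have sr: "searching E n M Z {} (s' ''mk'') (s' ''q'') (s' ''qh'' 0) (s' ''qt'' 0)"
      using I by (simp add: Inv_def)
    have fr: "s' h = s h" "s' x = s x" "s' d = s d"
      using I names by (auto simp: Inv_def intro!: agreeD)
    have "?v < n"
      using sr lt unfolding searching_def by blast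
    then obtain js where js: "chain (s x) (s h ?v) js" "s d ` set js = E `` {?v}" "length js = deg ?v"
      using adj unfolding adjacency_def by blast
    have K: "K + search_credits n deg (s' ''q'') (Suc (s' ''qh'' 0)) + 46 + 40 * length js \<le> k'"
      using I search_credits_pop[OF sr lt, of deg] js(3) by (simp add: Inv_def)
    let ?s = "set_var ''qh'' (Suc (s' ''qh'' 0)) (set_var ''e'' (s h ?v) s')"
    \<comment> \<open>18 is the outer test and the two assignments, at 6 each.\<close>
    have "Inner (k' - 18) ?s"
      unfolding Inner_def
    proof (intro exI conjI)
      show "chain (s x) (?s ''e'' 0) js"
        using js(1) by simp
      show "Inv (s d ` set js) (9 + 40 * length js) (k' - 18) ?s"
        using I K searching_pop[OF sr lt E Z] js(2) by (simp add: Inv_def agree_upd)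
    qed
    moreover have "wp (scan x d) (Inv {} 6) k1 s1"
      if "Inner k1 s1" for k1 s1
      unfolding scan_def
    proof (rule wp_WhileNz[where I = Inner])
      show "Inner k1 s1" by fact
    next
      fix k2 s2 assume "Inner k2 s2" and e: "expr_val (var ''e'') s2 \<noteq> 0"
      then obtain js' where js': "chain (s x) (s2 ''e'' 0) js'" "s2 ''e'' 0 \<noteq> 0"
        and I2': "Inv (s d ` set js') (9 + 40 * length js') k2 s2"
        unfolding Inner_def by auto
      then obtain j js where "js' = j # js"
        by (cases js') auto
      with js' I2' have js: "s2 ''e'' 0 = Suc j" "chain (s x) (s x j) js"
        and I2: "Inv (s d ` set (j # js)) (9 + 40 * length (j # js)) k2 s2"
        by auto
      have fr2: "s2 x = s x" "s2 d = s d"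
        using I2 names by (auto simp: Inv_def intro!: agreeD)
      have K2: "K + search_credits n deg (s2 ''q'') (s2 ''qh'' 0) + 49 + 40 * length js \<le> k2"
        using I2 by (simp add: Inv_def)
      have sr2: "searching E n M Z (insert (s d j) (s d ` set js)) (s2 ''mk'') (s2 ''q'') (s2 ''qh'' 0) (s2 ''qt'' 0)"
        using I2 by (simp add: Inv_def)
      have "wp (visit d) (wp (follow x) Inner) (k2 - 3) s2"
        unfolding visit_def
      proof (rule wp_IfNz)
        assume "expr_val (Cell ''mk'' (Cell d (Sub (var ''e'') (Num 1)))) s2 \<noteq> 0"
        then have "searching E n M Z (s d ` set js) (s2 ''mk'') (s2 ''q'') (s2 ''qh'' 0) (s2 ''qt'' 0)"
          using searching_skip[OF sr2] js(1) fr2 by simp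
        then show "wp Skip (wp (follow x) Inner)
          (k2 - 3 - (1 + expr_time (Cell ''mk'' (Cell d (Sub (var ''e'') (Num 1)))))) s2"
          using I2 K2 js fr2
          unfolding wp_Skip follow_def wp_Assign Inner_def
          by (intro conjI exI[of _ js]) (simp_all add: Inv_def agree_upd)
      next
        assume m: "expr_val (Cell ''mk'' (Cell d (Sub (var ''e'') (Num 1)))) s2 = 0"
        let ?y = "s d j"
        have y: "s2 ''mk'' ?y = 0"
          using m js(1) fr2 by simp
        moreover have "?y < n" "?y \<in> Z"
          using sr2 y unfolding searching_def by auto
        ultimately have "searching E n M Z (insert ?y (s d ` set js)) ((s2 ''mk'')(?y := 1))
            ((s2 ''q'')(s2 ''qt'' 0 := ?y)) (s2 ''qh'' 0) (Suc (s2 ''qt'' 0))"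
          by (rule searching_push[OF sr2])
        then have "searching E n M Z (s d ` set js) ((s2 ''mk'')(?y := 1))
            ((s2 ''q'')(s2 ''qt'' 0 := ?y)) (s2 ''qh'' 0) (Suc (s2 ''qt'' 0))"
          by (rule searching_skip) simp
        moreover have "search_credits n deg ((s2 ''q'')(s2 ''qt'' 0 := ?y)) (s2 ''qh'' 0) =
            search_credits n deg (s2 ''q'') (s2 ''qh'' 0)"
          using sr2 by (intro search_credits_push) (simp add: searching_def)
        ultimately show "wp (Seq (Assign ''mk'' (Cell d (Sub (var ''e'') (Num 1))) (Num 1))
          (Seq (Assign ''q'' (var ''qt'') (Cell d (Sub (var ''e'') (Num 1))))
          (Assign ''qt'' (Num 0) (Add (var ''qt'') (Num 1)))))
          (wp (follow x) Inner)
          (k2 - 3 - (1 + expr_time (Cell ''mk'' (Cell d (Sub (var ''e'') (Num 1)))))) s2"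
          using I2 K2 js fr2 names
          unfolding wp_Seq follow_def wp_Assign Inner_def
          by (intro conjI exI[of _ js]) (simp_all add: Inv_def agree_upd)
      qed (use K2 in simp)
      moreover have "1 + expr_time (var ''e'') = 3"
        by simp
      ultimately show "1 + expr_time (var ''e'') \<le> k2 \<and>
        wp (Seq (visit d) (follow x)) Inner (k2 - (1 + expr_time (var ''e''))) s2"
        using K2 unfolding wp_Seq by presburger
    next
      fix k2 s2 assume "Inner k2 s2" and "expr_val (var ''e'') s2 = 0"
      then obtain js where "chain (s x) 0 js" "Inv (s d ` set js) (9 + 40 * length js) k2 s2"
        unfolding Inner_def by auto
      then have "Inv {} 9 k2 s2"
        by (cases js) auto
      then show "1 + expr_time (var ''e'') \<le> k2 \<and> Inv {} 6 (k2 - (1 + expr_time (var ''e''))) s2"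
        by (auto simp: Inv_def)
    qed
    ultimately have "wp (scan x d) (Inv {} 6) (k' - 18) ?s"
      by blast
    then show "1 + expr_time (Sub (var ''qt'') (var ''qh'')) \<le> k' \<and>
      wp (Seq (Assign ''e'' (Num 0) (Cell h (Cell ''q'' (var ''qh''))))
     (Seq (Assign ''qh'' (Num 0) (Add (var ''qh'') (Num 1)))
     (scan x d))) (Inv {} 6)
       (k' - (1 + expr_time (Sub (var ''qt'') (var ''qh'')))) s'"
      using K fr by (auto simp: wp_Seq wp_Assign Suc_eq_plus1 simp del: One_nat_def)
  next
    fix k' s' assume I: "Inv {} 6 k' s'" and b: "expr_val (Sub (var ''qt'') (var ''qh'')) s' = 0"
    then have "s' ''qh'' 0 = s' ''qt'' 0"
      by (auto simp: Inv_def searching_def)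
    then show "1 + expr_time (Sub (var ''qt'') (var ''qh'')) \<le> k' \<and>
      Q (k' - (1 + expr_time (Sub (var ''qt'') (var ''qh'')))) s'"
      using I by (intro conjI post) (auto simp: Inv_def)
  qed
qed

lemma adjacency_indexed:
  assumes "indexed h x a m" "E = (\<lambda>j. (a j, d j)) ` {..<m}"
  shows "adjacency h x d n E (\<lambda>v. card {j. j < m \<and> a j = v})"
  unfolding adjacency_def
proof (intro allI impI)
  fix v
  obtain js where js: "chain x (h v) js" "distinct js" "set js = {j. j < m \<and> a j = v}"
    using assms(1) unfolding indexed_def by blast
  moreover have "d ` set js = E `` {v}"
    unfolding js(3) assms(2) by auto
  moreover have "length js = card {j. j < m \<and> a j = v}"
    using js(2,3) by (metis distinct_card)
  ultimately show "\<exists>js. chain x (h v) js \<and> d ` set js = E `` {v} \<and> length js = card {j. j < m \<and> a j = v}"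
    by blast
qed

text \<open>The arc lists of different vertices are disjoint sets of indices below \<open>m\<close>,
  so the degrees add up to at most \<open>m\<close>.\<close>

lemma search_credits_le:
  "search_credits n (\<lambda>v. card {j. j < m \<and> a j = v}) q 0 \<le> 40 * n + 40 * m"
proof -
  have "(\<Sum>v<n. card {j. j < m \<and> a j = v}) = card (\<Union>v<n. {j. j < m \<and> a j = v})"
    by (intro card_UN_disjoint[symmetric]) auto
  also have "\<dots> \<le> card {..<m}"
    by (intro card_mono) auto
  finally have "(\<Sum>v<n. card {j. j < m \<and> a j = v}) \<le> m"
    by simp
  then show ?thesis
    by (simp add: search_credits_def sum.distrib flip: sum_distrib_left)
qed

lemma searching_start:
  "(\<forall>y<n. mk y \<noteq> 0 \<longleftrightarrow> y \<in> M) \<Longrightarrow> searching E n M Z {} mk q 0 0"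
  by (simp add: searching_def)

lemma searching_mono:
  "searching E n M Z {} mk q qh qt \<Longrightarrow> q ` {..<qt} \<subseteq> Z' \<Longrightarrow> searching E n M Z' {} mk q qh qt"
  unfolding searching_def by blast

lemma searching_finished:
  assumes "searching E n M Z {} mk q qt qt" "E \<subseteq> {..<n} \<times> {..<n}"
  shows "E `` (q ` {..<qt}) \<subseteq> q ` {..<qt} \<union> M"
proof
  fix y assume "y \<in> E `` (q ` {..<qt})"
  then obtain i where "i < qt" "(q i, y) \<in> E" by blast
  then have "mk y \<noteq> 0" "y < n"
    using assms unfolding searching_def by blast+
  then show "y \<in> q ` {..<qt} \<union> M"
    using assms unfolding searching_def by blast
qed

text \<open>Copying the labels into \<open>mk\<close> makes labelled vertices look already found,
  which confines the search to open ones. Old contents of \<open>q\<close> are harmless, as only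
  cells below \<open>qt\<close> count.\<close>

definition start_search :: cmd where
  "start_search = Seq (For ''i'' ''n'' (Assign ''mk'' (var ''i'') (Cell ''lb'' (var ''i''))))
     (Seq (Assign ''qh'' (Num 0) (Num 0)) (Assign ''qt'' (Num 0) (Num 0)))"

lemma wp_start_search:
  assumes "s ''n'' 0 = n" "18 * n + 15 \<le> k"
    and post: "\<And>k' s'. \<lbrakk> agree {''i'', ''mk'', ''qh'', ''qt''} s s'; \<forall>y<n. s' ''mk'' y = s ''lb'' y;
        s' ''qh'' 0 = 0; s' ''qt'' 0 = 0; k - (18 * n + 15) \<le> k' \<rbrakk> \<Longrightarrow> Q k' s'"
  shows "wp start_search Q k s"
  unfolding start_search_def wp_Seq
proof (rule wp_For_const[where B = 6 and N = n and
      J = "\<lambda>i s'. agree {''i'', ''mk'', ''qh'', ''qt''} s s' \<and> (\<forall>y<i. s' ''mk'' y = s ''lb'' y)"])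
  fix i s' assume s': "s' ''i'' 0 = i" "s' ''n'' 0 = n"
    "agree {''i'', ''mk'', ''qh'', ''qt''} s s' \<and> (\<forall>y<i. s' ''mk'' y = s ''lb'' y)"
  then have "s' ''lb'' = s ''lb''"
    by (auto intro: agreeD)
  then show "wp (Assign ''mk'' (var ''i'') (Cell ''lb'' (var ''i'')))
    (\<lambda>k s'. s' ''i'' 0 = i \<and> s' ''n'' 0 = n \<and> agree {''i'', ''mk'', ''qh'', ''qt''} s (set_var ''i'' (Suc i) s') \<and>
      (\<forall>y<Suc i. (set_var ''i'' (Suc i) s') ''mk'' y = s ''lb'' y)) 6 s'"
    using s' by (simp add: wp_Assign agree_upd less_Suc_eq)
next
  fix k' s' assume s': "agree {''i'', ''mk'', ''qh'', ''qt''} s s' \<and> (\<forall>y<n. s' ''mk'' y = s ''lb'' y)"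
    and k': "k - ((6 + 12) * n + 9) \<le> k'"
  have "6 \<le> k'"
    using k' assms(2) by simp
  have "Q (k' - 3 - 3) (set_var ''qt'' 0 (set_var ''qh'' 0 s'))"
    using s' k' assms(2) by (intro post) (auto simp: agree_upd)
  then show "wp (Assign ''qh'' (Num 0) (Num 0)) (wp (Assign ''qt'' (Num 0) (Num 0)) Q) k' s'"
    using \<open>6 \<le> k'\<close> by (simp add: wp_Assign eval_nat_numeral)
qed (use assms in \<open>simp_all add: agree_upd agree_refl\<close>)

definition seed :: "expr \<Rightarrow> cmd" where
  "seed e = Seq (Assign ''mk'' e (Num 1))
     (Seq (Assign ''q'' (var ''qt'') e) (Assign ''qt'' (Num 0) (Add (var ''qt'') (Num 1))))"

text \<open>\<open>e\<close> is evaluated a second time after the write to \<open>mk\<close>, hence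
  the first assumption.\<close>

lemma wp_seed:
  assumes "\<And>f. expr_val e (s(''mk'' := f)) = expr_val e s"
    and "11 + 2 * expr_time e \<le> k"
    and "\<And>s'. \<lbrakk> agree {''mk'', ''q'', ''qt''} s s'; s' ''mk'' = (s ''mk'')(expr_val e s := 1);
        s' ''q'' = (s ''q'')(s ''qt'' 0 := expr_val e s); s' ''qt'' 0 = Suc (s ''qt'' 0) \<rbrakk>
        \<Longrightarrow> Q (k - (11 + 2 * expr_time e)) s'"
  shows "wp (seed e) Q k s"
proof -
  let ?s = "set_var ''qt'' (Suc (s ''qt'' 0)) (s(''mk'' := (s ''mk'')(expr_val e s := 1),
    ''q'' := (s ''q'')(s ''qt'' 0 := expr_val e s)))"
  have "Q (k - (11 + 2 * expr_time e)) ?s"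
    by (rule assms(3)) (simp_all add: agree_upd agree_refl)
  moreover have "k - (1 + expr_time e + 1) - (1 + 2 + expr_time e) - 6 = k - (11 + 2 * expr_time e)"
    by simp
  ultimately show ?thesis
    using assms(1,2) by (auto simp: seed_def wp_Seq wp_Assign eval_nat_numeral)
qed

subsection \<open>Finding a sink component\<close>

definition outside :: "('a \<times> 'a) set \<Rightarrow> 'a set \<Rightarrow> ('a \<times> 'a) set" where
  "outside E M = {(x, y) \<in> E. x \<notin> M \<and> y \<notin> M}"

lemma outside_reachable_notin:
  "(x, y) \<in> (outside E M)\<^sup>* \<Longrightarrow> x \<notin> M \<Longrightarrow> y \<notin> M"
  by (induction rule: rtrancl_induct) (auto simp: outside_def)

lemma outside_reachable_closed:
  assumes "x \<notin> M"
  shows "E `` ((outside E M)\<^sup>* `` {x}) \<subseteq> (outside E M)\<^sup>* `` {x} \<union> M"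
proof
  fix z assume "z \<in> E `` ((outside E M)\<^sup>* `` {x})"
  then obtain y where y: "(x, y) \<in> (outside E M)\<^sup>*" "(y, z) \<in> E" by blast
  show "z \<in> (outside E M)\<^sup>* `` {x} \<union> M"
  proof (cases "z \<in> M")
    case False
    then have "(y, z) \<in> outside E M"
      using y outside_reachable_notin[OF y(1) assms] by (simp add: outside_def)
    with y(1) show ?thesis by (auto intro: rtrancl_into_rtrancl)
  qed simp
qed

lemma outside_reachable_in:
  assumes "(x, y) \<in> (outside E M)\<^sup>*" "x \<in> Y" "E `` Y \<subseteq> Y \<union> M"
  shows "y \<in> Y"
  using assms(1,2) by (induction rule: rtrancl_induct) (use assms(3) in \<open>auto simp: outside_def\<close>)

text \<open>Starting a new search from every vertex not found before, the last root \<open>la - 1\<close> can be reached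
  only from vertices reachable from it: what was found before is a closed set \<open>Y\<close> without it.\<close>

definition swept :: "(nat \<times> nat) set \<Rightarrow> nat \<Rightarrow> nat set \<Rightarrow> nat \<Rightarrow>
    (nat \<Rightarrow> nat) \<Rightarrow> (nat \<Rightarrow> nat) \<Rightarrow> nat \<Rightarrow> nat \<Rightarrow> bool" where
  "swept E n M i mk q qt la \<longleftrightarrow> searching E n M UNIV {} mk q qt qt \<and> (\<forall>y<i. mk y \<noteq> 0) \<and>
     (case la of 0 \<Rightarrow> qt = 0 | Suc l \<Rightarrow> l < n \<and> l \<notin> M \<and>
       (\<exists>Y. E `` Y \<subseteq> Y \<union> M \<and> l \<notin> Y \<and> q ` {..<qt} \<subseteq> Y \<union> (outside E M)\<^sup>* `` {l}))"

lemma swept_skip: "swept E n M i mk q qt la \<Longrightarrow> mk i \<noteq> 0 \<Longrightarrow> swept E n M (Suc i) mk q qt la"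
  by (auto simp: swept_def less_Suc_eq)

text \<open>The new witness for \<open>Y\<close> is the old queue: a finished search leaves it
  closed up to \<open>M\<close>, and \<open>i\<close> is not in it because it was unmarked.\<close>

lemma swept_search:
  assumes "swept E n M i mk q qt la" "mk i = 0" "i < n" "E \<subseteq> {..<n} \<times> {..<n}"
    and "searching E n M (q ` {..<qt} \<union> (outside E M)\<^sup>* `` {i}) {} mk' q' qt' qt'"
    and "\<forall>y. (mk(i := 1)) y \<noteq> 0 \<longrightarrow> mk' y \<noteq> 0"
  shows "swept E n M (Suc i) mk' q' qt' (Suc i)"
proof -
  have sr: "searching E n M UNIV {} mk q qt qt"
    using assms(1) by (simp add: swept_def)
  have "searching E n M UNIV {} mk' q' qt' qt'"
    by (rule searching_mono[OF assms(5)]) simp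
  moreover have "\<forall>y<Suc i. mk' y \<noteq> 0"
    using assms(1,6) by (auto simp: swept_def less_Suc_eq)
  moreover have "i \<notin> M \<union> q ` {..<qt}"
    using sr assms(2,3) unfolding searching_def by blast
  moreover have "q' ` {..<qt'} \<subseteq> q ` {..<qt} \<union> (outside E M)\<^sup>* `` {i}"
    using assms(5) unfolding searching_def by blast
  ultimately show ?thesis
    using assms(3) searching_finished[OF sr assms(4)] unfolding swept_def by auto
qed

text \<open>In \<open>E\<close> this says that the component of \<open>l\<close> is a source among
  the vertices outside \<open>M\<close>. The program uses reversed arcs for \<open>E\<close>, which
  turns it into a sink of the game graph.\<close>

definition sink_root :: "(nat \<times> nat) set \<Rightarrow> nat \<Rightarrow> nat set \<Rightarrow> nat \<Rightarrow> bool" where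
  "sink_root E n M l \<longleftrightarrow> l < n \<and> l \<notin> M \<and>
     (\<forall>y<n. y \<notin> M \<longrightarrow> (y, l) \<in> (outside E M)\<^sup>* \<longrightarrow> (l, y) \<in> (outside E M)\<^sup>*)"

lemma swept_finished:
  assumes "swept E n M n mk q qt la"
  shows "la = 0 \<and> {..<n} \<subseteq> M \<or> (\<exists>l. la = Suc l \<and> sink_root E n M l)"
proof -
  have q: "y \<in> M \<union> q ` {..<qt}" if "y < n" for y
    using assms that unfolding swept_def searching_def by blast
  show ?thesis
  proof (cases la)
    case 0
    then have "qt = 0"
      using assms by (simp add: swept_def)
    with 0 q show ?thesis by auto
  next
    case (Suc l)
    then obtain Y where Y: "l < n" "l \<notin> M" "E `` Y \<subseteq> Y \<union> M" "l \<notin> Y"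
      "q ` {..<qt} \<subseteq> Y \<union> (outside E M)\<^sup>* `` {l}"
      using assms by (auto simp: swept_def)
    have "(l, y) \<in> (outside E M)\<^sup>*" if "y < n" "y \<notin> M" "(y, l) \<in> (outside E M)\<^sup>*" for y
    proof -
      have "y \<notin> Y"
        using outside_reachable_in[OF that(3) _ Y(3)] Y(4) by blast
      then show ?thesis
        using q[OF that(1)] that(2) Y(5) by blast
    qed
    with Suc Y show ?thesis
      by (simp add: sink_root_def)
  qed
qed

definition sweep :: cmd where
  "sweep = For ''i'' ''n'' (IfNz (Cell ''mk'' (var ''i'')) Skip
     (Seq (Assign ''la'' (Num 0) (Add (var ''i'') (Num 1)))
     (Seq (seed (var ''i'')) (drain ''hr'' ''nr'' ''src''))))"

text \<open>All roots share one potential. In addition each \<open>i\<close> gets 31 = 4 + 6 + 15 +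
  6 for the test, recording the root, seeding, and the last test of \<open>drain\<close>; 43 adds
  the 12 of the loop.\<close>

lemma wp_sweep:
  assumes adj: "adjacency (s ''hr'') (s ''nr'') (s ''src'') n E deg"
    and E: "E \<subseteq> {..<n} \<times> {..<n}" and n: "s ''n'' 0 = n"
    and init: "searching E n M UNIV {} (s ''mk'') (s ''q'') 0 0"
      "s ''qh'' 0 = 0" "s ''qt'' 0 = 0" "s ''la'' 0 = 0"
    and credits: "K + search_credits n deg (s ''q'') 0 + 43 * n + 9 \<le> k"
    and post: "\<And>k' s'. \<lbrakk> agree ({''i'', ''la''} \<union> search_vars) s s';
        s' ''la'' 0 = 0 \<and> {..<n} \<subseteq> M \<or> (\<exists>l. s' ''la'' 0 = Suc l \<and> sink_root E n M l); K \<le> k' \<rbrakk>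
        \<Longrightarrow> Q k' s'"
  shows "wp sweep Q k s"
  unfolding sweep_def
proof (rule wp_For[where N = n and J = "\<lambda>i k' s'. agree ({''i'', ''la''} \<union> search_vars) s s' \<and>
      s' ''qh'' 0 = s' ''qt'' 0 \<and> swept E n M i (s' ''mk'') (s' ''q'') (s' ''qt'' 0) (s' ''la'' 0) \<and>
      K + search_credits n deg (s' ''q'') (s' ''qt'' 0) + 31 * (n - i) \<le> k'"])
  fix i k' s'
  assume i: "i < n" "s' ''i'' 0 = i" "s' ''n'' 0 = n" and J:
    "agree ({''i'', ''la''} \<union> search_vars) s s' \<and>
      s' ''qh'' 0 = s' ''qt'' 0 \<and> swept E n M i (s' ''mk'') (s' ''q'') (s' ''qt'' 0) (s' ''la'' 0) \<and>
      K + search_credits n deg (s' ''q'') (s' ''qt'' 0) + 31 * (n - i) \<le> k'"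
  have "31 * (n - i) = 31 * (n - Suc i) + 31"
    using i by linarith
  then have k': "K + search_credits n deg (s' ''q'') (s' ''qt'' 0) + 31 * (n - Suc i) + 31 \<le> k'"
    using J by linarith
  let ?R = "\<lambda>k'' s''. s'' ''i'' 0 = i \<and> s'' ''n'' 0 = n \<and>
      agree ({''i'', ''la''} \<union> search_vars) s (set_var ''i'' (Suc i) s'') \<and>
      (set_var ''i'' (Suc i) s'') ''qh'' 0 = (set_var ''i'' (Suc i) s'') ''qt'' 0 \<and>
      swept E n M (Suc i) ((set_var ''i'' (Suc i) s'') ''mk'') ((set_var ''i'' (Suc i) s'') ''q'')
        ((set_var ''i'' (Suc i) s'') ''qt'' 0) ((set_var ''i'' (Suc i) s'') ''la'' 0) \<and>
      K + search_credits n deg ((set_var ''i'' (Suc i) s'') ''q'') ((set_var ''i'' (Suc i) s'') ''qt'' 0)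
        + 31 * (n - Suc i) \<le> k''"
  show "wp (IfNz (Cell ''mk'' (var ''i'')) Skip
     (Seq (Assign ''la'' (Num 0) (Add (var ''i'') (Num 1)))
     (Seq (seed (var ''i'')) (drain ''hr'' ''nr'' ''src'')))) ?R k' s'"
  proof (rule wp_IfNz)
    show "1 + expr_time (Cell ''mk'' (var ''i'')) \<le> k'"
      using k' by simp
  next
    assume "expr_val (Cell ''mk'' (var ''i'')) s' \<noteq> 0"
    then have "swept E n M (Suc i) (s' ''mk'') (s' ''q'') (s' ''qt'' 0) (s' ''la'' 0)"
      using J i by (intro swept_skip) simp_all
    then show "wp Skip ?R (k' - (1 + expr_time (Cell ''mk'' (var ''i'')))) s'"
      using J i k' by (auto simp: wp_Skip agree_upd)
  next
    assume "expr_val (Cell ''mk'' (var ''i'')) s' = 0"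
    then have mk: "s' ''mk'' i = 0"
      using i by simp
    let ?q = "s' ''q''" and ?qt = "s' ''qt'' 0"
    \<comment> \<open>This bound is closed up to \<open>M\<close>, and it guarantees that the search
      from \<open>i\<close> adds nothing but vertices reachable from \<open>i\<close>.\<close>
    let ?Z = "?q ` {..<?qt} \<union> (outside E M)\<^sup>* `` {i}"
    have sw: "swept E n M i (s' ''mk'') ?q ?qt (s' ''la'' 0)"
      using J by simp
    then have sr: "searching E n M UNIV {} (s' ''mk'') ?q ?qt ?qt"
      by (simp add: swept_def)
    have "i \<notin> M"
      using sr mk i(1) unfolding searching_def by blast
    have Z: "E `` ?Z \<subseteq> ?Z \<union> M"
      using searching_finished[OF sr E] outside_reachable_closed[OF \<open>i \<notin> M\<close>, of E] by blast
    have push: "searching E n M ?Z {} ((s' ''mk'')(i := 1)) (?q(?qt := i)) ?qt (Suc ?qt)"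
      using mk i(1) by (intro searching_push searching_mono[OF sr]) auto
    let ?s1 = "set_var ''la'' (Suc i) s'"
    have "wp (seed (var ''i'')) (wp (drain ''hr'' ''nr'' ''src'') ?R) (k' - 10) ?s1"
    proof (rule wp_seed)
      fix s2 assume s2: "agree {''mk'', ''q'', ''qt''} ?s1 s2"
        "s2 ''mk'' = (?s1 ''mk'')(expr_val (var ''i'') ?s1 := 1)"
        "s2 ''q'' = (?s1 ''q'')(?s1 ''qt'' 0 := expr_val (var ''i'') ?s1)"
        "s2 ''qt'' 0 = Suc (?s1 ''qt'' 0)"
      have s2': "s2 ''mk'' = (s' ''mk'')(i := 1)" "s2 ''q'' = ?q(?qt := i)" "s2 ''qt'' 0 = Suc ?qt"
        using s2(2-4) i(2) by simp_all
      have s2'': "s2 ''qh'' 0 = ?qt" "s2 ''la'' 0 = Suc i" "s2 ''i'' 0 = i" "s2 ''n'' 0 = n"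
        using agreeD[OF s2(1), of "''qh''"] agreeD[OF s2(1), of "''la''"]
          agreeD[OF s2(1), of "''i''"] agreeD[OF s2(1), of "''n''"] i J by simp_all
      have ag: "agree ({''i'', ''la''} \<union> search_vars) s s2"
        using J s2(1) agree_trans[of "{''i'', ''la''} \<union> search_vars" s ?s1 "{''mk'', ''q'', ''qt''}" s2]
        by (simp add: agree_upd)
      show "wp (drain ''hr'' ''nr'' ''src'') ?R (k' - 10 - (11 + 2 * expr_time (var ''i''))) s2"
      proof (rule wp_drain[where n = n and E = E and deg = deg and M = M and Z = ?Z and
            K = "K + 31 * (n - Suc i)"])
        show "adjacency (s2 ''hr'') (s2 ''nr'') (s2 ''src'') n E deg"
          using adj agreeD[OF ag, of "''hr''"] agreeD[OF ag, of "''nr''"] agreeD[OF ag, of "''src''"]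
          by simp
        show "searching E n M ?Z {} (s2 ''mk'') (s2 ''q'') (s2 ''qh'' 0) (s2 ''qt'' 0)"
          using push by (simp only: s2' s2'')
        have "search_credits n deg (?q(?qt := i)) ?qt = search_credits n deg ?q ?qt"
          by (rule search_credits_push) simp
        then show "K + 31 * (n - Suc i) + search_credits n deg (s2 ''q'') (s2 ''qh'' 0) + 6
            \<le> k' - 10 - (11 + 2 * expr_time (var ''i''))"
          using k' by (simp add: s2' s2'')
      next
        fix k3 s3 assume s3: "agree search_vars s2 s3" "\<forall>y. s2 ''mk'' y \<noteq> 0 \<longrightarrow> s3 ''mk'' y \<noteq> 0"
          "s3 ''qh'' 0 = s3 ''qt'' 0"
          "searching E n M ?Z {} (s3 ''mk'') (s3 ''q'') (s3 ''qt'' 0) (s3 ''qt'' 0)"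
          "K + 31 * (n - Suc i) + search_credits n deg (s3 ''q'') (s3 ''qt'' 0) \<le> k3"
        have "s3 ''la'' 0 = Suc i" "s3 ''i'' 0 = i" "s3 ''n'' 0 = n"
          using agreeD[OF s3(1), of "''la''"] agreeD[OF s3(1), of "''i''"] agreeD[OF s3(1), of "''n''"]
            s2'' by simp_all
        moreover have "swept E n M (Suc i) (s3 ''mk'') (s3 ''q'') (s3 ''qt'' 0) (Suc i)"
          using s3(2) by (intro swept_search[OF sw mk i(1) E s3(4)]) (simp only: s2')
        moreover have "agree ({''i'', ''la''} \<union> search_vars) s s3"
          by (rule agree_trans[OF ag s3(1)]) simp
        ultimately show "?R k3 s3"
          using s3(3,5) by (simp add: agree_upd)
      qed (use E Z in simp_all)
    qed (use k' in simp_all)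
    then show "wp (Seq (Assign ''la'' (Num 0) (Add (var ''i'') (Num 1)))
      (Seq (seed (var ''i'')) (drain ''hr'' ''nr'' ''src''))) ?R
      (k' - (1 + expr_time (Cell ''mk'' (var ''i'')))) s'"
      using k' i(2) by (auto simp: wp_Seq wp_Assign Suc_eq_plus1 simp del: One_nat_def)
  qed
next
  fix k' s' assume J:
    "agree ({''i'', ''la''} \<union> search_vars) s s' \<and>
      s' ''qh'' 0 = s' ''qt'' 0 \<and> swept E n M n (s' ''mk'') (s' ''q'') (s' ''qt'' 0) (s' ''la'' 0) \<and>
      K + search_credits n deg (s' ''q'') (s' ''qt'' 0) + 31 * (n - n) \<le> k'"
  then have "swept E n M n (s' ''mk'') (s' ''q'') (s' ''qt'' 0) (s' ''la'' 0)"
    by simp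
  from swept_finished[OF this] show "Q k' s'"
    using J by (intro post) simp_all
next
  show "agree ({''i'', ''la''} \<union> search_vars) s (set_var ''i'' 0 s) \<and>
      (set_var ''i'' 0 s) ''qh'' 0 = (set_var ''i'' 0 s) ''qt'' 0 \<and>
      swept E n M 0 ((set_var ''i'' 0 s) ''mk'') ((set_var ''i'' 0 s) ''q'')
        ((set_var ''i'' 0 s) ''qt'' 0) ((set_var ''i'' 0 s) ''la'' 0) \<and>
      K + search_credits n deg ((set_var ''i'' 0 s) ''q'') ((set_var ''i'' 0 s) ''qt'' 0) + 31 * (n - 0)
        \<le> k - (12 * n + 9)"
    using init credits by (simp add: agree_upd agree_refl swept_def)
qed (use n credits in simp_all)

subsection \<open>Labelling by sink components\<close>

text \<open>Labels: 0 open, 1 losing, 2 winning. By the last conjunct no open vertex has an arc to a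
  losing one, so arcs from open vertices into the labelled part end in winning vertices, as
  \<open>labelling\<close> demands of a sink component.\<close>

definition labelled :: "(nat \<times> nat) set \<Rightarrow> nat \<Rightarrow> nat set \<Rightarrow> (nat \<Rightarrow> nat) \<Rightarrow> bool" where
  "labelled A n H lb \<longleftrightarrow> labelling A H {y. y < n \<and> lb y = 1} {y. y < n \<and> lb y = 2} \<and>
     (\<forall>y<n. lb y \<le> 2) \<and> (\<forall>x y. x < n \<longrightarrow> lb x = 0 \<longrightarrow> (x, y) \<in> A \<longrightarrow> lb y \<noteq> 1)"

text \<open>\<open>C\<close> is the outcome of the forward search from \<open>l\<close>. The root
  property, read in the reversed graph, supplies the paths back to \<open>l\<close>; closedness up
  to \<open>M\<close> keeps all these paths inside \<open>C\<close>.\<close>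

lemma sink_root_strong_on:
  assumes "sink_root (A\<inverse>) n M l" "A \<subseteq> {..<n} \<times> {..<n}"
    and "C \<subseteq> (outside A M)\<^sup>* `` {l}" "A `` C \<subseteq> C \<union> M" "l \<in> C" "C \<subseteq> {..<n} - M"
  shows "strong_on A C"
proof -
  have conv: "outside (A\<inverse>) M = (outside A M)\<inverse>"
    by (auto simp: outside_def)
  have stay: "(x, y) \<in> (A \<inter> C \<times> C)\<^sup>*" if "(x, y) \<in> (outside A M)\<^sup>*" "x \<in> C" for x y
    using that
  proof (induction rule: rtrancl_induct)
    case (step y z)
    have "y \<in> C"
      using outside_reachable_in[OF step(1) \<open>x \<in> C\<close> assms(4)] .
    moreover have "z \<in> C"
      using outside_reachable_in[OF rtrancl_into_rtrancl[OF step(1,2)] \<open>x \<in> C\<close> assms(4)] .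
    ultimately have "(y, z) \<in> A \<inter> C \<times> C"
      using step(2) by (auto simp: outside_def)
    with step show ?case
      by (blast intro: rtrancl_into_rtrancl)
  qed simp
  have "(x, l) \<in> (outside A M)\<^sup>*" "(l, x) \<in> (outside A M)\<^sup>*" if "x \<in> C" for x
  proof -
    show "(l, x) \<in> (outside A M)\<^sup>*"
      using assms(3) that by blast
    then have "(x, l) \<in> (outside (A\<inverse>) M)\<^sup>*"
      by (simp add: conv rtrancl_converse)
    then have "(l, x) \<in> (outside (A\<inverse>) M)\<^sup>*"
      using assms(1,6) that unfolding sink_root_def by blast
    then show "(x, l) \<in> (outside A M)\<^sup>*"
      by (simp add: conv rtrancl_converse)
  qed
  then show ?thesis
    unfolding strong_on_def using stay by (meson rtrancl_trans)
qed

text \<open>\<open>lb1\<close> is the state after labelling \<open>C\<close>: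
  \<open>2 - card C mod 2\<close> is 1 for odd and 2 for even size. \<open>lb2\<close> is the state
  after relabelling open predecessors. By the invariant, the losing successors of such predecessors
  can only be new ones, that is, in \<open>C\<close>.\<close>

lemma labelled_step:
  assumes lab: "labelled A n H lb" and A: "A \<subseteq> {..<n} \<times> {..<n}"
    and C: "strong_on A C" "A `` C \<subseteq> C \<union> {y. lb y \<noteq> 0}" "C \<subseteq> {y. y < n \<and> lb y = 0}"
    and lb1: "\<And>y. lb1 y = (if y \<in> C then 2 - card C mod 2 else lb y)"
    and lb2: "\<And>y. lb2 y = (if lb1 y = 0 \<and> (\<exists>z. (y, z) \<in> A \<and> lb1 z = 1) then 2 else lb1 y)"
  shows "labelled A n H lb2"
proof -
  let ?P = "\<lambda>lb. {y. y < n \<and> lb y = (1 :: nat)}" and ?N = "\<lambda>lb. {y. y < n \<and> lb y = (2 :: nat)}"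
  have L: "labelling A H (?P lb) (?N lb)" and le: "\<And>y. y < n \<Longrightarrow> lb y \<le> 2"
    and noP: "\<And>x y. x < n \<Longrightarrow> lb x = 0 \<Longrightarrow> (x, y) \<in> A \<Longrightarrow> lb y \<noteq> 1"
    using lab unfolding labelled_def by auto
  have fin: "finite C"
    by (rule finite_subset[of _ "{..<n}"]) (use C(3) in auto)
  have sink: "A `` C \<subseteq> C \<union> ?N lb"
  proof
    fix y assume "y \<in> A `` C"
    then obtain x where x: "x \<in> C" "(x, y) \<in> A" by blast
    then have "y < n" "x < n" "lb x = 0" "y \<in> C \<or> lb y \<noteq> 0"
      using A C(2,3) by auto
    then show "y \<in> C \<union> ?N lb"
      using noP[of x y] le[of y] x(2) by auto
  qed
  have disj: "C \<inter> (?P lb \<union> ?N lb) = {}"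
    using C(3) by auto
  have "labelling A H (?P lb2) (?N lb2)"
  proof (cases "odd (card C)")
    case True
    then have lb1': "lb1 y = (if y \<in> C then 1 else lb y)" for y
      unfolding lb1 by (simp add: odd_iff_mod_2_eq_one)
    let ?X = "{y. y < n \<and> lb1 y = 0 \<and> (\<exists>z. (y, z) \<in> A \<and> lb1 z = 1)}"
    have "labelling A H (?P lb \<union> C) (?N lb \<union> ?X)"
    proof (rule labelling.odd[OF L fin True C(1) sink disj])
      show "?X \<inter> (?P lb \<union> ?N lb \<union> C) = {}"
        by (auto simp: lb1' split: if_splits)
      show "\<forall>x\<in>?X. A `` {x} \<inter> C \<noteq> {}"
      proof
        fix x assume "x \<in> ?X"
        then obtain z where z: "(x, z) \<in> A" "lb1 z = 1" "x < n" "lb1 x = 0"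
          by blast
        then have "lb x = 0"
          using lb1'[of x] by (cases "x \<in> C") auto
        then have "lb z \<noteq> 1"
          by (rule noP[OF z(3) _ z(1)])
        with z(2) have "z \<in> C"
          using lb1'[of z] by (cases "z \<in> C") auto
        with z(1) show "A `` {x} \<inter> C \<noteq> {}"
          by blast
      qed
    qed
    moreover have "?P lb \<union> C = ?P lb2"
      using C(3) by (auto simp: lb2 lb1')
    moreover have "?N lb \<union> ?X = ?N lb2"
      using C(3) by (auto simp: lb2 lb1')
    ultimately show ?thesis by simp
  next
    case False
    then have lb1': "lb1 y = (if y \<in> C then 2 else lb y)" for y
      unfolding lb1 by simp
    \<comment> \<open>In the even case no losing vertex is new, so relabelling predecessors changes
      nothing.\<close>
    have lb2': "lb2 y = lb1 y" if "y < n" for y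
      using noP[OF that] by (auto simp: lb2 lb1' split: if_splits)
    have "labelling A H (?P lb) (?N lb \<union> C)"
      using False by (intro labelling.even[OF L fin _ C(1) sink disj]) simp
    moreover have "?P lb = ?P lb2"
      using C(3) by (auto simp: lb2' lb1' split: if_splits)
    moreover have "?N lb \<union> C = ?N lb2"
      using C(3) by (auto simp: lb2' lb1' split: if_splits)
    ultimately show ?thesis by simp
  qed
  moreover have "\<forall>y<n. lb2 y \<le> 2"
    using le by (simp add: lb2 lb1)
  moreover have "\<forall>x y. x < n \<longrightarrow> lb2 x = 0 \<longrightarrow> (x, y) \<in> A \<longrightarrow> lb2 y \<noteq> 1"
    by (auto simp: lb2 split: if_splits)
  ultimately show ?thesis
    unfolding labelled_def by blast
qed

text \<open>The machine has no division; the parity of \<open>qt\<close> is obtained by flipping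
  \<open>p\<close> once per queue entry.\<close>

definition label_found :: cmd where
  "label_found = Seq (Assign ''p'' (Num 0) (Num 0))
     (Seq (For ''i'' ''qt'' (Assign ''p'' (Num 0) (Sub (Num 1) (var ''p''))))
     (For ''i'' ''qt'' (Assign ''lb'' (Cell ''q'' (var ''i'')) (Sub (Num 2) (var ''p'')))))"

lemma wp_label_found:
  assumes c: "s ''qt'' 0 = c" and k: "38 * c + 21 \<le> k"
    and post: "\<And>k' s'. \<lbrakk> agree {''p'', ''i'', ''lb''} s s';
        \<And>y. s' ''lb'' y = (if y \<in> s ''q'' ` {..<c} then 2 - c mod 2 else s ''lb'' y);
        k - (38 * c + 21) \<le> k' \<rbrakk> \<Longrightarrow> Q k' s'"
  shows "wp label_found Q k s"
proof -
  let ?L = "For ''i'' ''qt'' (Assign ''lb'' (Cell ''q'' (var ''i'')) (Sub (Num 2) (var ''p'')))"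
  have L: "wp ?L Q k1 s1"
    if s1: "agree {''p'', ''i''} s s1" "s1 ''p'' 0 = c mod 2" "k - (18 * c + 12) \<le> k1" for k1 s1
  proof (rule wp_For_const[where B = 8 and N = c and J = "\<lambda>i s'. agree {''p'', ''i'', ''lb''} s s' \<and>
        s' ''p'' 0 = c mod 2 \<and>
        (\<forall>y. s' ''lb'' y = (if y \<in> s ''q'' ` {..<i} then 2 - c mod 2 else s ''lb'' y))"])
    show "s1 ''qt'' 0 = c"
      using agreeD[OF s1(1), of "''qt''"] c by simp
    show "(8 + 12) * c + 9 \<le> k1"
      using s1(3) k by simp
    have "s1 ''lb'' = s ''lb''"
      using agreeD[OF s1(1), of "''lb''"] by simp
    moreover have "agree {''p'', ''i'', ''lb''} s s1"
      using s1(1) by (rule agree_trans[OF agree_refl]) simp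
    ultimately show "agree {''p'', ''i'', ''lb''} s (set_var ''i'' 0 s1) \<and>
        (set_var ''i'' 0 s1) ''p'' 0 = c mod 2 \<and>
        (\<forall>y. (set_var ''i'' 0 s1) ''lb'' y = (if y \<in> s ''q'' ` {..<0} then 2 - c mod 2 else s ''lb'' y))"
      using s1 by (simp add: agree_upd)
  next
    fix i s' assume s': "s' ''i'' 0 = i" "s' ''qt'' 0 = c"
      and J: "agree {''p'', ''i'', ''lb''} s s' \<and> s' ''p'' 0 = c mod 2 \<and>
        (\<forall>y. s' ''lb'' y = (if y \<in> s ''q'' ` {..<i} then 2 - c mod 2 else s ''lb'' y))"
    have "s' ''q'' = s ''q''"
      using J by (auto intro: agreeD)
    then show "wp (Assign ''lb'' (Cell ''q'' (var ''i'')) (Sub (Num 2) (var ''p'')))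
      (\<lambda>k s'. s' ''i'' 0 = i \<and> s' ''qt'' 0 = c \<and> agree {''p'', ''i'', ''lb''} s (set_var ''i'' (Suc i) s') \<and>
        (set_var ''i'' (Suc i) s') ''p'' 0 = c mod 2 \<and>
        (\<forall>y. (set_var ''i'' (Suc i) s') ''lb'' y =
          (if y \<in> s ''q'' ` {..<Suc i} then 2 - c mod 2 else s ''lb'' y))) 8 s'"
      using s' J by (simp add: wp_Assign agree_upd lessThan_Suc)
  next
    fix k' s' assume "agree {''p'', ''i'', ''lb''} s s' \<and> s' ''p'' 0 = c mod 2 \<and>
        (\<forall>y. s' ''lb'' y = (if y \<in> s ''q'' ` {..<c} then 2 - c mod 2 else s ''lb'' y))"
      and "k1 - ((8 + 12) * c + 9) \<le> k'"
    then show "Q k' s'"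
      using s1(3) by (intro post) simp_all
  qed simp
  have "wp (For ''i'' ''qt'' (Assign ''p'' (Num 0) (Sub (Num 1) (var ''p'')))) (wp ?L Q) (k - 3)
    (set_var ''p'' 0 s)"
  proof (rule wp_For_const[where B = 6 and N = c and
        J = "\<lambda>i s'. agree {''p'', ''i''} s s' \<and> s' ''p'' 0 = i mod 2"])
    fix i s' assume "s' ''i'' 0 = i" "s' ''qt'' 0 = c" "agree {''p'', ''i''} s s' \<and> s' ''p'' 0 = i mod 2"
    moreover have "1 - i mod 2 = Suc i mod 2"
      by presburger
    ultimately show "wp (Assign ''p'' (Num 0) (Sub (Num 1) (var ''p'')))
      (\<lambda>k s'. s' ''i'' 0 = i \<and> s' ''qt'' 0 = c \<and> agree {''p'', ''i''} s (set_var ''i'' (Suc i) s') \<and>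
        (set_var ''i'' (Suc i) s') ''p'' 0 = Suc i mod 2) 6 s'"
      by (simp add: wp_Assign agree_upd)
  next
    fix k' s' assume "agree {''p'', ''i''} s s' \<and> s' ''p'' 0 = c mod 2"
      "k - 3 - ((6 + 12) * c + 9) \<le> k'"
    then show "wp ?L Q k' s'"
      by (intro L) auto
  qed (use c k in \<open>simp_all add: agree_upd agree_refl\<close>)
  then show ?thesis
    using k by (simp add: label_found_def wp_Seq wp_Assign numeral_3_eq_3)
qed

text \<open>The two outer tests express that the label is 1: truncated subtraction of 1 gives 0, and
  the label itself is nonzero.\<close>

definition spread :: cmd where
  "spread = For ''j'' ''m'' (IfNz (Sub (Cell ''lb'' (Cell ''dst'' (var ''j''))) (Num 1)) Skip
     (IfNz (Cell ''lb'' (Cell ''dst'' (var ''j'')))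
       (IfNz (Cell ''lb'' (Cell ''src'' (var ''j''))) Skip
         (Assign ''lb'' (Cell ''src'' (var ''j'')) (Num 2)))
       Skip))"

text \<open>Labels change in place during the scan, but only from 0 to 2. The cells with label 1
  stay fixed, so the order of the arcs is irrelevant.\<close>

lemma wp_spread:
  assumes m: "s ''m'' 0 = m" and k: "34 * m + 9 \<le> k"
    and post: "\<And>k' s'. \<lbrakk> agree {''j'', ''lb''} s s';
        \<And>y. s' ''lb'' y = (if s ''lb'' y = 0 \<and> (\<exists>j<m. s ''src'' j = y \<and> s ''lb'' (s ''dst'' j) = 1)
          then 2 else s ''lb'' y) \<rbrakk> \<Longrightarrow> Q k' s'"
  shows "wp spread Q k s"
  unfolding spread_def
proof (rule wp_For_const[where B = 22 and N = m and J = "\<lambda>i s'. agree {''j'', ''lb''} s s' \<and>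
      (\<forall>y. s' ''lb'' y = (if s ''lb'' y = 0 \<and> (\<exists>j<i. s ''src'' j = y \<and> s ''lb'' (s ''dst'' j) = 1)
          then 2 else s ''lb'' y))"])
  fix i s' assume s': "s' ''j'' 0 = i" "s' ''m'' 0 = m" and
    J: "agree {''j'', ''lb''} s s' \<and>
      (\<forall>y. s' ''lb'' y = (if s ''lb'' y = 0 \<and> (\<exists>j<i. s ''src'' j = y \<and> s ''lb'' (s ''dst'' j) = 1)
          then 2 else s ''lb'' y))"
  let ?R = "\<lambda>k s'. s' ''j'' 0 = i \<and> s' ''m'' 0 = m \<and> agree {''j'', ''lb''} s (set_var ''j'' (Suc i) s') \<and>
      (\<forall>y. (set_var ''j'' (Suc i) s') ''lb'' y =
        (if s ''lb'' y = 0 \<and> (\<exists>j<Suc i. s ''src'' j = y \<and> s ''lb'' (s ''dst'' j) = 1) then 2 else s ''lb'' y))"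
  have fr: "s' ''src'' = s ''src''" "s' ''dst'' = s ''dst''"
    using J by (auto intro: agreeD)
  let ?x = "s ''src'' i" and ?y = "s ''dst'' i"
  have lb: "s' ''lb'' y = (if s ''lb'' y = 0 \<and> (\<exists>j<i. s ''src'' j = y \<and> s ''lb'' (s ''dst'' j) = 1)
      then 2 else s ''lb'' y)" for y
    using J by blast
  have one: "s' ''lb'' y = 1 \<longleftrightarrow> s ''lb'' y = 1" for y
    by (simp add: lb)
  have skip: "?R k s'" if "s ''lb'' ?y \<noteq> 1 \<or> s' ''lb'' ?x \<noteq> 0" for k
    using that s' J by (auto simp: agree_upd less_Suc_eq split: if_splits)
  have set: "?R k (s'(''lb'' := (s' ''lb'')(?x := 2)))" if "s ''lb'' ?y = 1" "s' ''lb'' ?x = 0" for k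
    using that s' J by (auto simp: agree_upd less_Suc_eq split: if_splits)
  show "wp (IfNz (Sub (Cell ''lb'' (Cell ''dst'' (var ''j''))) (Num 1)) Skip
     (IfNz (Cell ''lb'' (Cell ''dst'' (var ''j'')))
       (IfNz (Cell ''lb'' (Cell ''src'' (var ''j''))) Skip
         (Assign ''lb'' (Cell ''src'' (var ''j'')) (Num 2)))
       Skip)) ?R 22 s'"
  proof (intro wp_IfNz)
    assume "expr_val (Sub (Cell ''lb'' (Cell ''dst'' (var ''j''))) (Num 1)) s' \<noteq> 0"
    then have "s' ''lb'' ?y \<noteq> 1"
      using s' fr by simp
    then show "wp Skip ?R (22 - (1 + expr_time (Sub (Cell ''lb'' (Cell ''dst'' (var ''j''))) (Num 1)))) s'"
      using skip one by (simp add: wp_Skip del: fun_upd_apply)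
  next
    assume "expr_val (Cell ''lb'' (Cell ''dst'' (var ''j''))) s' = 0"
    then have "s' ''lb'' ?y \<noteq> 1"
      using s' fr by simp
    then show "wp Skip ?R (22 - (1 + expr_time (Sub (Cell ''lb'' (Cell ''dst'' (var ''j''))) (Num 1)))
      - (1 + expr_time (Cell ''lb'' (Cell ''dst'' (var ''j''))))) s'"
      using skip one by (simp add: wp_Skip del: fun_upd_apply)
  next
    assume "expr_val (Cell ''lb'' (Cell ''src'' (var ''j''))) s' \<noteq> 0"
    then have "s' ''lb'' ?x \<noteq> 0"
      using s' fr by simp
    then show "wp Skip ?R (22 - (1 + expr_time (Sub (Cell ''lb'' (Cell ''dst'' (var ''j''))) (Num 1)))
      - (1 + expr_time (Cell ''lb'' (Cell ''dst'' (var ''j''))))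
      - (1 + expr_time (Cell ''lb'' (Cell ''src'' (var ''j''))))) s'"
      using skip by (simp add: wp_Skip del: fun_upd_apply)
  next
    assume "expr_val (Sub (Cell ''lb'' (Cell ''dst'' (var ''j''))) (Num 1)) s' = 0"
      "expr_val (Cell ''lb'' (Cell ''dst'' (var ''j''))) s' \<noteq> 0"
      "expr_val (Cell ''lb'' (Cell ''src'' (var ''j''))) s' = 0"
    then have "s' ''lb'' ?y = 1" "s' ''lb'' ?x = 0"
      using s' fr by simp_all
    then have "?R k (s'(''lb'' := (s' ''lb'')(?x := 2)))" for k
      using set one by blast
    then show "wp (Assign ''lb'' (Cell ''src'' (var ''j'')) (Num 2)) ?R
      (22 - (1 + expr_time (Sub (Cell ''lb'' (Cell ''dst'' (var ''j''))) (Num 1)))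
      - (1 + expr_time (Cell ''lb'' (Cell ''dst'' (var ''j''))))
      - (1 + expr_time (Cell ''lb'' (Cell ''src'' (var ''j''))))) s'"
      using s' fr by (simp add: wp_Assign del: fun_upd_apply)
  qed simp_all
next
  fix k' s' assume "agree {''j'', ''lb''} s s' \<and>
      (\<forall>y. s' ''lb'' y = (if s ''lb'' y = 0 \<and> (\<exists>j<m. s ''src'' j = y \<and> s ''lb'' (s ''dst'' j) = 1)
          then 2 else s ''lb'' y))"
  then show "Q k' s'"
    by (intro post) blast+
qed (use m k in \<open>simp_all add: agree_upd agree_refl\<close>)

subsection \<open>The program\<close>

abbreviation round_vars :: "string set" where
  "round_vars \<equiv> {''i'', ''j'', ''la'', ''p'', ''lb''} \<union> search_vars"

definition label_round :: cmd where
  "label_round = Seq start_search (Seq (Assign ''la'' (Num 0) (Num 0)) (Seq sweep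
     (IfNz (var ''la'')
       (Seq start_search (Seq (seed (Sub (var ''la'') (Num 1))) (Seq (drain ''hf'' ''nf'' ''dst'')
         (Seq label_found spread))))
       Skip)))"

definition prepared :: "memory \<Rightarrow> nat \<Rightarrow> (nat \<times> nat) list \<Rightarrow> bool" where
  "prepared s n es \<longleftrightarrow> s ''n'' 0 = n \<and> s ''m'' 0 = length es \<and>
     (\<forall>j<length es. (s ''src'' j, s ''dst'' j) = es ! j) \<and>
     indexed (s ''hf'') (s ''nf'') (s ''src'') (length es) \<and>
     indexed (s ''hr'') (s ''nr'') (s ''dst'') (length es)"

lemma prepared_agree:
  assumes "prepared s n es" "agree X s s'"
    and "X \<inter> {''n'', ''m'', ''src'', ''dst'', ''hf'', ''nf'', ''hr'', ''nr''} = {}"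
  shows "prepared s' n es"
proof -
  have "s' a = s a" if "a \<in> {''n'', ''m'', ''src'', ''dst'', ''hf'', ''nf'', ''hr'', ''nr''}" for a
    using assms(2,3) that by (intro agreeD) auto
  then show ?thesis
    using assms(1) by (simp add: prepared_def)
qed

lemma prepared_arcs:
  assumes "prepared s n es"
  shows "set es = (\<lambda>j. (s ''src'' j, s ''dst'' j)) ` {..<length es}"
    and "(set es)\<inverse> = (\<lambda>j. (s ''dst'' j, s ''src'' j)) ` {..<length es}"
proof -
  have "set es = (\<lambda>j. es ! j) ` {..<length es}"
    by (auto simp: set_conv_nth)
  also have "\<dots> = (\<lambda>j. (s ''src'' j, s ''dst'' j)) ` {..<length es}"
    by (intro image_cong) (use assms in \<open>auto simp: prepared_def\<close>)
  finally show *: "set es = (\<lambda>j. (s ''src'' j, s ''dst'' j)) ` {..<length es}" .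
  show "(set es)\<inverse> = (\<lambda>j. (s ''dst'' j, s ''src'' j)) ` {..<length es}"
    unfolding * by auto
qed

text \<open>The subtraction is truncated: once nothing is open, a further round merely preserves
  this. Otherwise at least the root \<open>l\<close> stops being open.\<close>

lemma wp_label_round:
  assumes prep: "prepared s n es" and A: "set es \<subseteq> {..<n} \<times> {..<n}"
    and lab: "labelled (set es) n H (s ''lb'')"
  shows "wp label_round (\<lambda>_ s'. agree round_vars s s' \<and> labelled (set es) n H (s' ''lb'') \<and>
      card {y. y < n \<and> s' ''lb'' y = 0} \<le> card {y. y < n \<and> s ''lb'' y = 0} - 1)
    (200 * n + 120 * length es + 150) s"
    (is "wp _ ?R ?k s")
proof -
  let ?m = "length es" and ?A = "set es"
  define M where "M = {y. s ''lb'' y \<noteq> 0}"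
  let ?dr = "\<lambda>v. card {j. j < ?m \<and> s ''dst'' j = v}" and ?df = "\<lambda>v. card {j. j < ?m \<and> s ''src'' j = v}"
  have A': "?A\<inverse> \<subseteq> {..<n} \<times> {..<n}"
    using A by auto
  have n: "s ''n'' 0 = n" and m: "s ''m'' 0 = ?m"
    using prep by (auto simp: prepared_def)
  have adjr: "adjacency (s ''hr'') (s ''nr'') (s ''src'') n (?A\<inverse>) ?dr"
    using prep prepared_arcs(2)[OF prep] by (intro adjacency_indexed) (auto simp: prepared_def)
  have adjf: "adjacency (s ''hf'') (s ''nf'') (s ''dst'') n ?A ?df"
    using prep prepared_arcs(1)[OF prep] by (intro adjacency_indexed) (auto simp: prepared_def)
  show ?thesis
    unfolding label_round_def wp_Seq
  proof (rule wp_start_search)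
    show "s ''n'' 0 = n" by (fact n)
  next
    fix k1 s1 assume s1: "agree {''i'', ''mk'', ''qh'', ''qt''} s s1" "\<forall>y<n. s1 ''mk'' y = s ''lb'' y"
      "s1 ''qh'' 0 = 0" "s1 ''qt'' 0 = 0" "?k - (18 * n + 15) \<le> k1"
    let ?s2 = "set_var ''la'' 0 s1"
    have ag2: "agree round_vars s ?s2"
      using agree_trans[OF agree_refl s1(1), of round_vars] by (simp add: agree_upd)
    note fr2 = agreeD[OF ag2]
    have "wp sweep (wp (IfNz (var ''la'')
       (Seq start_search (Seq (seed (Sub (var ''la'') (Num 1))) (Seq (drain ''hf'' ''nf'' ''dst'')
         (Seq label_found spread)))) Skip) ?R) (k1 - 3) ?s2"
    \<comment> \<open>The sweep uses the reversed arcs. \<open>K\<close> pays for the rest of the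
      round: 96 = 18 + 40 + 38 per vertex for resetting the marks, the forward search and labelling
      the component, and 74 = 40 + 34 per arc for the search and \<open>spread\<close>.\<close>
    proof (rule wp_sweep[where E = "?A\<inverse>" and n = n and M = M and deg = ?dr and K = "96 * n + 74 * ?m + 110"])
      show "adjacency (?s2 ''hr'') (?s2 ''nr'') (?s2 ''src'') n (?A\<inverse>) ?dr"
        using adjr fr2[of "''hr''"] fr2[of "''nr''"] fr2[of "''src''"] by simp
      show "searching (?A\<inverse>) n M UNIV {} (?s2 ''mk'') (?s2 ''q'') 0 0"
        using s1(2) by (intro searching_start) (simp add: M_def)
      show "96 * n + 74 * ?m + 110 + search_credits n ?dr (?s2 ''q'') 0 + 43 * n + 9 \<le> k1 - 3"
        using search_credits_le[of n ?m "s ''dst''" "?s2 ''q''"] s1(5) by simp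
      show "?s2 ''n'' 0 = n"
        using fr2[of "''n''"] n by simp
    next
      fix k3 s3 assume s3: "agree ({''i'', ''la''} \<union> search_vars) ?s2 s3"
        "s3 ''la'' 0 = 0 \<and> {..<n} \<subseteq> M \<or> (\<exists>l. s3 ''la'' 0 = Suc l \<and> sink_root (?A\<inverse>) n M l)"
        "96 * n + 74 * ?m + 110 \<le> k3"
      have ag3: "agree round_vars s s3"
        by (rule agree_trans[OF ag2 s3(1)]) simp
      have lb3: "s3 ''lb'' = s ''lb''"
        using agreeD[OF s3(1), of "''lb''"] agreeD[OF s1(1), of "''lb''"] by simp
      show "wp (IfNz (var ''la'')
         (Seq start_search (Seq (seed (Sub (var ''la'') (Num 1))) (Seq (drain ''hf'' ''nf'' ''dst'')
         (Seq label_found spread)))) Skip) ?R k3 s3"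
      proof (rule wp_IfNz)
        show "1 + expr_time (var ''la'') \<le> k3"
          using s3(3) by simp
      next
        assume "expr_val (var ''la'') s3 = 0"
        then have "{y. y < n \<and> s ''lb'' y = 0} = {}"
          using s3(2) by (auto simp: M_def)
        then have "card {y. y < n \<and> s ''lb'' y = 0} = 0"
          by (simp only: card.empty)
        then have "?R k s3" for k
          unfolding lb3 using ag3 lab by (intro conjI) (assumption | simp only:)+
        then show "wp Skip ?R (k3 - (1 + expr_time (var ''la''))) s3"
          using s3(3) by (simp add: wp_Skip)
      next
        assume "expr_val (var ''la'') s3 \<noteq> 0"
        then obtain l where l: "s3 ''la'' 0 = Suc l" "sink_root (?A\<inverse>) n M l"
          using s3(2) by auto
        have l': "l < n" "l \<notin> M"
          using l(2) by (simp_all add: sink_root_def)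
        show "wp (Seq start_search (Seq (seed (Sub (var ''la'') (Num 1))) (Seq (drain ''hf'' ''nf'' ''dst'')
         (Seq label_found spread)))) ?R (k3 - (1 + expr_time (var ''la''))) s3"
          unfolding wp_Seq
        proof (rule wp_start_search)
          show "s3 ''n'' 0 = n"
            using agreeD[OF ag3, of "''n''"] n by simp
          show "18 * n + 15 \<le> k3 - (1 + expr_time (var ''la''))"
            using s3(3) by simp
        next
          fix k4 s4 assume s4: "agree {''i'', ''mk'', ''qh'', ''qt''} s3 s4"
            "\<forall>y<n. s4 ''mk'' y = s3 ''lb'' y" "s4 ''qh'' 0 = 0" "s4 ''qt'' 0 = 0"
            "k3 - (1 + expr_time (var ''la'')) - (18 * n + 15) \<le> k4"
          have k4: "78 * n + 74 * ?m + 92 \<le> k4"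
            using s4(5) s3(3) by simp
          have la4: "expr_val (Sub (var ''la'') (Num 1)) s4 = l"
            using agreeD[OF s4(1), of "''la''"] l(1) by simp
          have lb4: "s4 ''lb'' = s ''lb''"
            using agreeD[OF s4(1), of "''lb''"] lb3 by simp
          have ag4: "agree round_vars s s4"
            by (rule agree_trans[OF ag3 s4(1)]) simp
          \<comment> \<open>As an upper bound for the forward search, this yields that
            \<open>l\<close> reaches everything found.\<close>
          let ?Z = "(outside ?A M)\<^sup>* `` {l}"
          have st: "searching ?A n M ?Z {} (s4 ''mk'') (s4 ''q'') 0 0"
            using s4(2) lb3 by (intro searching_start) (simp add: M_def)
          have "s4 ''mk'' l = 0"
            using s4(2) lb3 l' by (simp add: M_def)
          then have push: "searching ?A n M ?Z {} ((s4 ''mk'')(l := 1)) ((s4 ''q'')(0 := l)) 0 (Suc 0)"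
            using l' by (intro searching_push[OF st]) auto
          show "wp (seed (Sub (var ''la'') (Num 1))) (wp (drain ''hf'' ''nf'' ''dst'')
            (wp label_found (wp spread ?R))) k4 s4"
          proof (rule wp_seed)
            show "11 + 2 * expr_time (Sub (var ''la'') (Num 1)) \<le> k4"
              using k4 by simp
          next
            fix s5 assume s5: "agree {''mk'', ''q'', ''qt''} s4 s5"
              "s5 ''mk'' = (s4 ''mk'')(expr_val (Sub (var ''la'') (Num 1)) s4 := 1)"
              "s5 ''q'' = (s4 ''q'')(s4 ''qt'' 0 := expr_val (Sub (var ''la'') (Num 1)) s4)"
              "s5 ''qt'' 0 = Suc (s4 ''qt'' 0)"
            have ag5: "agree round_vars s s5"
              by (rule agree_trans[OF ag4 s5(1)]) simp
            have qh5: "s5 ''qh'' 0 = 0"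
              using agreeD[OF s5(1), of "''qh''"] s4(3) by simp
            note s5' = s5(2-4)[unfolded la4 s4(4)]
            show "wp (drain ''hf'' ''nf'' ''dst'') (wp label_found (wp spread ?R))
              (k4 - (11 + 2 * expr_time (Sub (var ''la'') (Num 1)))) s5"
            proof (rule wp_drain[where n = n and E = ?A and deg = ?df and M = M and Z = ?Z and
                  K = "38 * n + 34 * ?m + 40"])
              show "adjacency (s5 ''hf'') (s5 ''nf'') (s5 ''dst'') n ?A ?df"
                using adjf agreeD[OF ag5, of "''hf''"] agreeD[OF ag5, of "''nf''"]
                  agreeD[OF ag5, of "''dst''"] by simp
              show "?A `` ?Z \<subseteq> ?Z \<union> M"
                by (rule outside_reachable_closed[OF l'(2)])
              show "searching ?A n M ?Z {} (s5 ''mk'') (s5 ''q'') (s5 ''qh'' 0) (s5 ''qt'' 0)"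
                using push by (simp only: s5' qh5)
              show "38 * n + 34 * ?m + 40 + search_credits n ?df (s5 ''q'') (s5 ''qh'' 0) + 6
                \<le> k4 - (11 + 2 * expr_time (Sub (var ''la'') (Num 1)))"
                using k4 search_credits_le[of n ?m "s ''src''" "s5 ''q''"] qh5 by simp
            next
              fix k6 s6 assume s6: "agree search_vars s5 s6" "\<forall>y. s5 ''mk'' y \<noteq> 0 \<longrightarrow> s6 ''mk'' y \<noteq> 0"
                "searching ?A n M ?Z {} (s6 ''mk'') (s6 ''q'') (s6 ''qt'' 0) (s6 ''qt'' 0)"
                "38 * n + 34 * ?m + 40 + search_credits n ?df (s6 ''q'') (s6 ''qt'' 0) \<le> k6"
              let ?C = "s6 ''q'' ` {..<s6 ''qt'' 0}"
              have ag6: "agree round_vars s s6"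
                by (rule agree_trans[OF ag5 s6(1)]) simp
              have lb6: "s6 ''lb'' = s ''lb''"
                using agreeD[OF s6(1), of "''lb''"] agreeD[OF s5(1), of "''lb''"] lb4 by simp
              have C: "?C \<subseteq> ?Z" "?C \<subseteq> {..<n} - M"
                using s6(3) unfolding searching_def by blast+
              have "s6 ''mk'' l \<noteq> 0"
                using s6(2) by (simp add: s5')
              then have "l \<in> ?C"
                using s6(3) l' unfolding searching_def by blast
              have closed: "?A `` ?C \<subseteq> ?C \<union> M"
                by (rule searching_finished[OF s6(3) A])
              have strong: "strong_on ?A ?C"
                by (rule sink_root_strong_on[OF l(2) A C(1) closed \<open>l \<in> ?C\<close> C(2)])
              have card: "card ?C = s6 ''qt'' 0"
                using s6(3) by (simp add: searching_def card_image)
              have le: "s6 ''qt'' 0 \<le> n"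
                by (rule searching_le[OF s6(3)])
              show "wp label_found (wp spread ?R) k6 s6"
              proof (rule wp_label_found[where s = s6, OF refl])
                show "38 * s6 ''qt'' 0 + 21 \<le> k6"
                  using le s6(4) by linarith
              next
                fix k7 s7 assume s7: "agree {''p'', ''i'', ''lb''} s6 s7"
                  "\<And>y. s7 ''lb'' y = (if y \<in> ?C then 2 - s6 ''qt'' 0 mod 2 else s6 ''lb'' y)"
                  "k6 - (38 * s6 ''qt'' 0 + 21) \<le> k7"
                have ag7: "agree round_vars s s7"
                  by (rule agree_trans[OF ag6 s7(1)]) simp
                have prep7: "prepared s7 n es"
                  by (rule prepared_agree[OF prep ag7]) simp
                show "wp spread ?R k7 s7"
                proof (rule wp_spread)
                  show "s7 ''m'' 0 = ?m"
                    using prep7 by (simp add: prepared_def)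
                  show "34 * ?m + 9 \<le> k7"
                    using s7(3) s6(4) le by linarith
                next
                  fix k8 s8 assume s8: "agree {''j'', ''lb''} s7 s8"
                    "\<And>y. s8 ''lb'' y = (if s7 ''lb'' y = 0 \<and>
                      (\<exists>j<?m. s7 ''src'' j = y \<and> s7 ''lb'' (s7 ''dst'' j) = 1) then 2 else s7 ''lb'' y)"
                  have "agree round_vars s s8"
                    by (rule agree_trans[OF ag7 s8(1)]) simp
                  moreover have arc: "(\<exists>j<?m. s7 ''src'' j = y \<and> s7 ''lb'' (s7 ''dst'' j) = 1) \<longleftrightarrow>
                      (\<exists>z. (y, z) \<in> ?A \<and> s7 ''lb'' z = 1)" for y
                    unfolding prepared_arcs(1)[OF prep7] by auto
                  have "labelled ?A n H (s8 ''lb'')"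
                  proof (rule labelled_step[OF lab A strong])
                    show "?A `` ?C \<subseteq> ?C \<union> {y. s ''lb'' y \<noteq> 0}"
                      using closed by (simp add: M_def)
                    show "?C \<subseteq> {y. y < n \<and> s ''lb'' y = 0}"
                      using C(2) by (auto simp: M_def)
                    show "s7 ''lb'' y = (if y \<in> ?C then 2 - card ?C mod 2 else s ''lb'' y)" for y
                      by (simp only: s7(2) card lb6)
                    show "s8 ''lb'' y = (if s7 ''lb'' y = 0 \<and> (\<exists>z. (y, z) \<in> ?A \<and> s7 ''lb'' z = 1)
                      then 2 else s7 ''lb'' y)" for y
                      by (simp only: s8(2) arc)
                  qed
                  \<comment> \<open>Labels written on the component are 1 or 2, never 0, so
                    \<open>l\<close> is no longer open; all other writes also only remove open
                    vertices.\<close>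
                  moreover have "{y. y < n \<and> s8 ''lb'' y = 0} \<subseteq> {y. y < n \<and> s ''lb'' y = 0} - {l}"
                  proof
                    fix y assume "y \<in> {y. y < n \<and> s8 ''lb'' y = 0}"
                    then have "y < n" "s7 ''lb'' y = 0"
                      by (auto simp: s8(2) split: if_splits)
                    moreover have "0 < 2 - c mod 2" for c :: nat
                      by simp
                    ultimately show "y \<in> {y. y < n \<and> s ''lb'' y = 0} - {l}"
                      using \<open>l \<in> ?C\<close> by (auto simp: s7(2) lb6 split: if_splits)
                  qed
                  then have "card {y. y < n \<and> s8 ''lb'' y = 0} \<le> card ({y. y < n \<and> s ''lb'' y = 0} - {l})"
                    by (intro card_mono) auto
                  moreover have "card ({y. y < n \<and> s ''lb'' y = 0} - {l}) = card {y. y < n \<and> s ''lb'' y = 0} - 1"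
                    using l' by (intro card_Diff_singleton) (simp add: M_def)
                  ultimately show "?R k8 s8"
                    by simp
                qed
              qed
            qed (use A in simp_all)
          qed simp
        qed
      qed
    qed (use A' s1 in simp_all)
    then show "wp (Assign ''la'' (Num 0) (Num 0)) (wp sweep (wp (IfNz (var ''la'')
       (Seq start_search (Seq (seed (Sub (var ''la'') (Num 1))) (Seq (drain ''hf'' ''nf'' ''dst'')
         (Seq label_found spread)))) Skip) ?R)) k1 s1"
      using s1(5) by (simp add: wp_Assign numeral_3_eq_3)
  qed simp
qed

definition init_labels :: cmd where
  "init_labels = For ''i'' ''n'' (IfNz (Sub (Cell ''w'' (var ''i'')) (Num 1))
     (Assign ''lb'' (var ''i'') (Num 2)) Skip)"

lemma wp_init_labels:
  assumes n: "s ''n'' 0 = n" and lb: "s ''lb'' = (\<lambda>_. 0)" and k: "22 * n + 9 \<le> k"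
    and post: "\<And>k' s'. \<lbrakk> agree {''i'', ''lb''} s s'; \<And>y. s' ''lb'' y = (if y < n \<and> 1 < s ''w'' y then 2 else 0);
        k - (22 * n + 9) \<le> k' \<rbrakk> \<Longrightarrow> Q k' s'"
  shows "wp init_labels Q k s"
  unfolding init_labels_def
proof (rule wp_For_const[where B = 10 and N = n and J = "\<lambda>i s'. agree {''i'', ''lb''} s s' \<and>
      (\<forall>y. s' ''lb'' y = (if y < i \<and> 1 < s ''w'' y then 2 else 0))"])
  fix i s' assume s': "s' ''i'' 0 = i" "s' ''n'' 0 = n"
    and J: "agree {''i'', ''lb''} s s' \<and> (\<forall>y. s' ''lb'' y = (if y < i \<and> 1 < s ''w'' y then 2 else 0))"
  let ?R = "\<lambda>k s'. s' ''i'' 0 = i \<and> s' ''n'' 0 = n \<and> agree {''i'', ''lb''} s (set_var ''i'' (Suc i) s') \<and>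
      (\<forall>y. (set_var ''i'' (Suc i) s') ''lb'' y = (if y < Suc i \<and> 1 < s ''w'' y then 2 else 0))"
  have w: "s' ''w'' = s ''w''"
    using J by (auto intro: agreeD)
  show "wp (IfNz (Sub (Cell ''w'' (var ''i'')) (Num 1)) (Assign ''lb'' (var ''i'') (Num 2)) Skip) ?R 10 s'"
  proof (rule wp_IfNz)
    assume "expr_val (Sub (Cell ''w'' (var ''i'')) (Num 1)) s' \<noteq> 0"
    then have "1 < s ''w'' i"
      using s' w by simp
    then show "wp (Assign ''lb'' (var ''i'') (Num 2)) ?R (10 - (1 + expr_time (Sub (Cell ''w'' (var ''i'')) (Num 1)))) s'"
      using s' J by (auto simp: wp_Assign agree_upd less_Suc_eq)
  next
    assume "expr_val (Sub (Cell ''w'' (var ''i'')) (Num 1)) s' = 0"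
    then have "\<not> 1 < s ''w'' i"
      using s' w by simp
    then show "wp Skip ?R (10 - (1 + expr_time (Sub (Cell ''w'' (var ''i'')) (Num 1)))) s'"
      using s' J by (auto simp: wp_Skip agree_upd less_Suc_eq)
  qed simp
next
  fix k' s' assume "agree {''i'', ''lb''} s s' \<and> (\<forall>y. s' ''lb'' y = (if y < n \<and> 1 < s ''w'' y then 2 else 0))"
    "k - ((10 + 12) * n + 9) \<le> k'"
  then show "Q k' s'"
    by (intro post) simp_all
qed (use n lb k in \<open>simp_all add: agree_upd agree_refl\<close>)

text \<open>The final subtraction decodes the label of \<open>u\<close>: losing (1) becomes answer
  1, winning (2) becomes answer 0.\<close>

definition vertexnim_prog :: cmd where
  "vertexnim_prog = Seq (index_arcs ''hf'' ''nf'' ''src'') (Seq (index_arcs ''hr'' ''nr'' ''dst'')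
     (Seq init_labels (Seq (For ''r'' ''n'' label_round)
     (Assign ''answer'' (Num 0) (Sub (Num 2) (Cell ''lb'' (var ''u'')))))))"

text \<open>There is no test for completion: after \<open>i\<close> rounds at most
  \<open>n - i\<close> vertices are open, and surplus rounds change no label.\<close>

lemma wp_rounds:
  assumes prep: "prepared s n es" and A: "set es \<subseteq> {..<n} \<times> {..<n}"
    and lab: "labelled (set es) n H (s ''lb'')" and k: "(200 * n + 120 * length es + 162) * n + 9 \<le> k"
    and post: "\<And>k' s'. \<lbrakk> agree (insert ''r'' round_vars) s s'; labelled (set es) n H (s' ''lb'');
      \<forall>y<n. s' ''lb'' y \<noteq> 0; k - ((200 * n + 120 * length es + 162) * n + 9) \<le> k' \<rbrakk> \<Longrightarrow> Q k' s'"
  shows "wp (For ''r'' ''n'' label_round) Q k s"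
proof (rule wp_For_const[where B = "200 * n + 120 * length es + 150" and N = n and
      J = "\<lambda>i s'. agree (insert ''r'' round_vars) s s' \<and> labelled (set es) n H (s' ''lb'') \<and>
        card {y. y < n \<and> s' ''lb'' y = 0} \<le> n - i"])
  fix i s' assume s': "s' ''r'' 0 = i" "s' ''n'' 0 = n" and J: "agree (insert ''r'' round_vars) s s' \<and>
    labelled (set es) n H (s' ''lb'') \<and> card {y. y < n \<and> s' ''lb'' y = 0} \<le> n - i"
  have "prepared s' n es"
    using J by (intro prepared_agree[OF prep, of "insert ''r'' round_vars"]) auto
  then have "wp label_round (\<lambda>_ s''. agree round_vars s' s'' \<and> labelled (set es) n H (s'' ''lb'') \<and>
      card {y. y < n \<and> s'' ''lb'' y = 0} \<le> card {y. y < n \<and> s' ''lb'' y = 0} - 1)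
    (200 * n + 120 * length es + 150) s'"
    using A J by (intro wp_label_round) auto
  then show "wp label_round (\<lambda>k s''. s'' ''r'' 0 = i \<and> s'' ''n'' 0 = n \<and>
      agree (insert ''r'' round_vars) s (set_var ''r'' (Suc i) s'') \<and>
      labelled (set es) n H ((set_var ''r'' (Suc i) s'') ''lb'') \<and>
      card {y. y < n \<and> (set_var ''r'' (Suc i) s'') ''lb'' y = 0} \<le> n - Suc i)
    (200 * n + 120 * length es + 150) s'"
  proof (rule wp_mono)
    fix k'' s'' assume *: "agree round_vars s' s'' \<and> labelled (set es) n H (s'' ''lb'') \<and>
      card {y. y < n \<and> s'' ''lb'' y = 0} \<le> card {y. y < n \<and> s' ''lb'' y = 0} - 1"
    have "s'' ''r'' = s' ''r''" "s'' ''n'' = s' ''n''"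
      using * by (auto intro: agreeD)
    moreover have "agree (insert ''r'' round_vars) s s''"
      using J * agree_trans[of "insert ''r'' round_vars" s s' round_vars s''] by auto
    ultimately show "s'' ''r'' 0 = i \<and> s'' ''n'' 0 = n \<and>
      agree (insert ''r'' round_vars) s (set_var ''r'' (Suc i) s'') \<and>
      labelled (set es) n H ((set_var ''r'' (Suc i) s'') ''lb'') \<and>
      card {y. y < n \<and> (set_var ''r'' (Suc i) s'') ''lb'' y = 0} \<le> n - Suc i"
      using s' J * by (auto simp: agree_upd)
  qed
next
  have "card {y. y < n \<and> s ''lb'' y = 0} \<le> card {..<n}"
    by (intro card_mono) auto
  then show "agree (insert ''r'' round_vars) s (set_var ''r'' 0 s) \<and>
    labelled (set es) n H ((set_var ''r'' 0 s) ''lb'') \<and>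
    card {y. y < n \<and> (set_var ''r'' 0 s) ''lb'' y = 0} \<le> n - 0"
    using lab by (simp add: agree_upd agree_refl)
next
  fix k' s' assume J: "agree (insert ''r'' round_vars) s s' \<and> labelled (set es) n H (s' ''lb'') \<and>
      card {y. y < n \<and> s' ''lb'' y = 0} \<le> n - n"
    and k': "k - ((200 * n + 120 * length es + 150 + 12) * n + 9) \<le> k'"
  have "finite {y. y < n \<and> s' ''lb'' y = 0}"
    by simp
  moreover have "card {y. y < n \<and> s' ''lb'' y = 0} = 0"
    using J by linarith
  ultimately have "\<forall>y<n. s' ''lb'' y \<noteq> 0"
    by simp
  moreover have "200 * n + 120 * length es + 150 + 12 = 200 * n + 120 * length es + 162"
    by simp
  ultimately show "Q k' s'"
    using J k' by (intro post) (simp_all only:)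
next
  show "(200 * n + 120 * length es + 150 + 12) * n + 9 \<le> k"
    using k by (simp add: algebra_simps)
qed (use prep in \<open>simp_all add: prepared_def\<close>)

lemma wp_vertexnim_prog:
  assumes A: "set es \<subseteq> {..<n} \<times> {..<n}" and n: "card (pverts G) = n" and u: "u < n"
    and H: "H = {v. v < n \<and> 1 < w v}"
    and k: "62 * length es + 22 * n + 50 + (200 * n + 120 * length es + 162) * n \<le> k"
  shows "wp vertexnim_prog (\<lambda>_ s'. \<exists>lb. labelled (set es) n H lb \<and> lb u \<noteq> 0 \<and> answer s' = 2 - lb u)
    k (input_memory G w u es)"
    (is "wp _ ?R k ?s")
proof -
  let ?m = "length es"
  define s where "s = ?s"
  have s: "s ''n'' 0 = n" "s ''m'' 0 = ?m" "s ''u'' 0 = u" "s ''lb'' = (\<lambda>_. 0)"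
    "s ''hf'' = (\<lambda>_. 0)" "s ''hr'' = (\<lambda>_. 0)" "\<And>y. y < n \<Longrightarrow> s ''w'' y = w y"
    "\<And>j. j < ?m \<Longrightarrow> (s ''src'' j, s ''dst'' j) = es ! j"
    using n by (simp_all add: s_def input_memory_def)
  have "wp vertexnim_prog ?R k s"
    unfolding vertexnim_prog_def wp_Seq
  proof (rule wp_index_arcs)
    fix k1 s1 assume s1: "agree {''hf'', ''nf'', ''j''} s s1"
      "indexed (s1 ''hf'') (s1 ''nf'') (s ''src'') ?m" "k - (31 * ?m + 9) \<le> k1"
    note fr1 = agreeD[OF s1(1)]
    show "wp (index_arcs ''hr'' ''nr'' ''dst'') (wp init_labels (wp (For ''r'' ''n'' label_round)
      (wp (Assign ''answer'' (Num 0) (Sub (Num 2) (Cell ''lb'' (var ''u'')))) ?R))) k1 s1"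
    proof (rule wp_index_arcs)
      show "s1 ''hr'' = (\<lambda>_. 0)" "s1 ''m'' 0 = ?m"
        using fr1[of "''hr''"] fr1[of "''m''"] s by simp_all
      show "31 * ?m + 9 \<le> k1"
        using s1(3) k by linarith
    next
      fix k2 s2 assume s2: "agree {''hr'', ''nr'', ''j''} s1 s2"
        "indexed (s2 ''hr'') (s2 ''nr'') (s1 ''dst'') ?m" "k1 - (31 * ?m + 9) \<le> k2"
      note fr2 = agreeD[OF s2(1)]
      have s2': "s2 ''n'' 0 = n" "s2 ''m'' 0 = ?m" "s2 ''u'' 0 = u" "s2 ''lb'' = (\<lambda>_. 0)"
        "s2 ''w'' = s ''w''" "s2 ''src'' = s ''src''" "s2 ''dst'' = s ''dst''"
        using fr1[of "''n''"] fr2[of "''n''"] fr1[of "''m''"] fr2[of "''m''"] fr1[of "''u''"] fr2[of "''u''"]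
          fr1[of "''lb''"] fr2[of "''lb''"] fr1[of "''w''"] fr2[of "''w''"]
          fr1[of "''src''"] fr2[of "''src''"] fr1[of "''dst''"] fr2[of "''dst''"] s by simp_all
      have prep2: "prepared s2 n es"
        using s2(2) s1(2) fr1[of "''dst''"] fr2[of "''hf''"] fr2[of "''nf''"] s(8) s2'
        by (simp add: prepared_def)
      show "wp init_labels (wp (For ''r'' ''n'' label_round)
        (wp (Assign ''answer'' (Num 0) (Sub (Num 2) (Cell ''lb'' (var ''u'')))) ?R)) k2 s2"
      proof (rule wp_init_labels)
        show "s2 ''n'' 0 = n" "s2 ''lb'' = (\<lambda>_. 0)"
          by (fact s2')+
        show "22 * n + 9 \<le> k2"
          using s2(3) s1(3) k by linarith
      next
        fix k3 s3 assume s3: "agree {''i'', ''lb''} s2 s3"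
          "\<And>y. s3 ''lb'' y = (if y < n \<and> 1 < s2 ''w'' y then 2 else 0)" "k2 - (22 * n + 9) \<le> k3"
        have prep3: "prepared s3 n es"
          by (rule prepared_agree[OF prep2 s3(1)]) simp
        have "{y. y < n \<and> s3 ''lb'' y = 1} = {}" "{y. y < n \<and> s3 ''lb'' y = 2} = H"
          using s(7) by (auto simp: s3(2) s2' H)
        then have "labelling (set es) H {y. y < n \<and> s3 ''lb'' y = 1} {y. y < n \<and> s3 ''lb'' y = 2}"
          by (simp only: labelling.heavy)
        then have lab3: "labelled (set es) n H (s3 ''lb'')"
          unfolding labelled_def by (rule conjI) (simp add: s3(2))
        show "wp (For ''r'' ''n'' label_round)
          (wp (Assign ''answer'' (Num 0) (Sub (Num 2) (Cell ''lb'' (var ''u'')))) ?R) k3 s3"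
        proof (rule wp_rounds[OF prep3 A lab3])
          show "(200 * n + 120 * ?m + 162) * n + 9 \<le> k3"
            using s3(3) s2(3) s1(3) k by linarith
        next
          fix k4 s4 assume s4: "agree (insert ''r'' round_vars) s3 s4" "labelled (set es) n H (s4 ''lb'')"
            "\<forall>y<n. s4 ''lb'' y \<noteq> 0" "k3 - ((200 * n + 120 * ?m + 162) * n + 9) \<le> k4"
          have "7 \<le> k4"
            using s4(4) s3(3) s2(3) s1(3) k by linarith
          moreover have "s4 ''u'' 0 = u"
            using agreeD[OF s4(1), of "''u''"] agreeD[OF s3(1), of "''u''"] s2'(3) by simp
          ultimately show "wp (Assign ''answer'' (Num 0) (Sub (Num 2) (Cell ''lb'' (var ''u'')))) ?R k4 s4"
            using s4(2) s4(3)[rule_format, OF u] by (simp add: wp_Assign answer_def) blast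
        qed
      qed
    qed simp
  qed (use s k in simp_all)
  then show ?thesis
    by (simp add: s_def)
qed

theorem theorem5:
  shows "\<exists>(prog :: cmd) (C :: nat).
    \<forall>(G :: nat pair_pre_digraph) (w :: nat \<Rightarrow> nat) (u :: nat) (es :: (nat \<times> nat) list).
      vertexnim_inst G w u \<longrightarrow>
      (\<forall>v \<in> pverts G. (v, v) \<in> parcs G) \<longrightarrow>
      pverts G = {..<card (pverts G)} \<longrightarrow>
      distinct es \<longrightarrow> set es = parcs G \<longrightarrow>
      (\<exists>t s. exec prog (input_memory G w u es) t s \<and>
             t \<le> C * (card (pverts G) * card (parcs G)) \<and>
             answer s \<in> {0, 1} \<and>
             (answer s = 1 \<longleftrightarrow> misere_P (G, w, u)) \<and>
             (answer s = 0 \<longleftrightarrow> misere_N (G, w, u)))"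
proof (rule exI[of _ vertexnim_prog], rule exI[of _ 700], intro allI impI)
  fix G :: "nat pair_pre_digraph" and w u es
  assume inst: "vertexnim_inst G w u" and loops: "\<forall>v \<in> pverts G. (v, v) \<in> parcs G"
    and V: "pverts G = {..<card (pverts G)}" and "distinct es" and es: "set es = parcs G"
  define n where "n = card (pverts G)"
  have V: "pverts G = {..<n}"
    using V by (simp add: n_def)
  let ?m = "length es"
  have m: "card (parcs G) = ?m"
    using \<open>distinct es\<close> es by (metis distinct_card)
  have reg: "regular (G, w, u)"
    by (rule vertexnim_inst_regular[OF inst loops])
  have A: "set es \<subseteq> {..<n} \<times> {..<n}"
    using reg by (simp add: V es)
  have u: "u < n"
    using inst by (simp add: vertexnim_inst_def V)
  \<comment> \<open>The loops are distinct arcs, one per vertex. The resulting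
    \<open>n \<le> ?m\<close> absorbs the \<open>n * n\<close> contributed by \<open>n\<close>
    rounds of cost linear in \<open>n\<close>.\<close>
  have "(\<lambda>v. (v, v)) ` {..<n} \<subseteq> set es"
    using loops V es by auto
  then have "card ((\<lambda>v. (v, v)) ` {..<n}) \<le> card (set es)"
    by (intro card_mono finite_set)
  then have nm: "n \<le> ?m"
    using m es by (simp add: card_image inj_on_def)
  \<comment> \<open>With every term bounded by \<open>n * ?m\<close>, the coefficients sum to 62 +
    22 + 50 + 200 + 120 + 162 = 616, which 700 rounds up.\<close>
  have "1 \<le> n * ?m" "?m \<le> n * ?m" "n \<le> n * ?m" "n * n \<le> n * ?m"
    using u nm by auto
  moreover have "(200 * n + 120 * ?m + 162) * n = 200 * (n * n) + 120 * (n * ?m) + 162 * n"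
    by (simp add: algebra_simps)
  ultimately have "62 * ?m + 22 * n + 50 + (200 * n + 120 * ?m + 162) * n \<le> 700 * (n * ?m)"
    by linarith
  then have "wp vertexnim_prog (\<lambda>_ s'. \<exists>lb. labelled (set es) n {v. v < n \<and> 1 < w v} lb \<and>
      lb u \<noteq> 0 \<and> answer s' = 2 - lb u) (700 * (n * ?m)) (input_memory G w u es)"
    by (intro wp_vertexnim_prog A u refl n_def[symmetric])
  then obtain t s lb where run: "exec vertexnim_prog (input_memory G w u es) t s" "t \<le> 700 * (n * ?m)"
    and lb: "labelled (set es) n {v. v < n \<and> 1 < w v} lb" "lb u \<noteq> 0" "answer s = 2 - lb u"
    unfolding wp_def by blast
  let ?P = "{y. y < n \<and> lb y = 1}" and ?N = "{y. y < n \<and> lb y = 2}"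
  have "labelling (parcs G) {v \<in> pverts G. 1 < w v} ?P ?N" "lb u \<le> 2"
    using lb(1) u by (simp_all add: labelled_def es V)
  moreover have "pverts G \<noteq> {}"
    using u V by auto
  ultimately have sound: "u \<in> ?P \<longrightarrow> loses (G, w, u)" "u \<in> ?N \<longrightarrow> wins (G, w, u)"
    using labelling_sound[OF reg] by blast+
  have excl: "\<not> (misere_P (G, w, u) \<and> misere_N (G, w, u))"
    by (rule regular_not_misere_P_and_N[OF reg])
  have "lb u = 1 \<or> lb u = 2"
    using lb(2) \<open>lb u \<le> 2\<close> by linarith
  then have "answer s \<in> {0, 1} \<and> (answer s = 1 \<longleftrightarrow> misere_P (G, w, u)) \<and>
    (answer s = 0 \<longleftrightarrow> misere_N (G, w, u))"
  proof
    assume "lb u = 1"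
    then have "misere_P (G, w, u)"
      using sound(1) u by (intro loses_imp_misere_P) simp
    with excl show ?thesis
      using lb(3) \<open>lb u = 1\<close> by simp
  next
    assume "lb u = 2"
    then have "misere_N (G, w, u)"
      using sound(2) u by (intro wins_imp_misere_N) simp
    with excl show ?thesis
      using lb(3) \<open>lb u = 2\<close> by simp
  qed
  with run show "\<exists>t s. exec vertexnim_prog (input_memory G w u es) t s \<and>
      t \<le> 700 * (card (pverts G) * card (parcs G)) \<and> answer s \<in> {0, 1} \<and>
      (answer s = 1 \<longleftrightarrow> misere_P (G, w, u)) \<and> (answer s = 0 \<longleftrightarrow> misere_N (G, w, u))"
    unfolding m n_def[symmetric] by (intro exI[of _ t] exI[of _ s] conjI) (simp only:)+
qed

end
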